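(* Let $\sigma$ be the Borel measure on $\mathbb{R}^2$ defined by $$\int f\,d\sigma:=\int_{-1/2}^{1/2}f\left(x,\sqrt{1-x^2}\right)dx.$$ Then $\{e^{-2\pi i x\cdot\lambda}\}_{\lambda\in\mathbb{Z}\times\{0\}}$ is an orthonormal basis of $L^2(\sigma)$, and there is a constant $C$ such that $|\widehat{\sigma}(\xi)|\leq C|\xi|^{-1/2}$ for all $\xi\in\mathbb{R}^2\setminus\{0\}$. Therefore $\sigma$ is a $1$-dimensional Salem measure in the plane with an orthonormal basis of exponentials.
   Context: $\widehat{\sigma}(\xi)=\int e^{-2\pi i x\cdot\xi}\,d\sigma(x)$. A nonzero finite compactly supported Borel measure $\mu$ on $\mathbb{R}^d$ is called a Salem measure if for every $\epsilon>0$ there is $C_\epsilon$ with $|\widehat{\mu}(\xi)|\leq C_\epsilon|\xi|^{-\dim_{\mathcal H}(\operatorname{supp}\mu)/2+\epsilon}$ for all $|\xi|\ge1$, where $\dim_{\mathcal H}$ is Hausdorff dimension. It is $t$-dimensional if $\dim_{\mathcal H}(\operatorname{supp}\mu)=t$. *)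

theory Defs
  imports "HOL-Analysis.Analysis"
begin

text \<open>The case distinction implements the convention $0^0 = 1$ for nonempty sets
  (Isabelle has \<open>0 powr 0 = 0\<close>).\<close>

definition hausdorff_gauge :: "real \<Rightarrow> 'a::metric_space set \<Rightarrow> ennreal" where
  "hausdorff_gauge s U =
     (if U = {} then 0 else if s = 0 then 1 else ennreal (diameter U powr s))"

text \<open>Boundedness is required explicitly, because \<^const>\<open>diameter\<close> is unspecified on
  unbounded sets. Finite covers are included, as the \<open>U i\<close> may be empty.\<close>

definition hausdorff_premeasure :: "real \<Rightarrow> real \<Rightarrow> 'a::metric_space set \<Rightarrow> ennreal" where
  "hausdorff_premeasure s \<delta> E =
     (INF U \<in> {U :: nat \<Rightarrow> 'a set. E \<subseteq> (\<Union>i. U i) \<and> (\<forall>i. bounded (U i) \<and> diameter (U i) \<le> \<delta>)}.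
        \<Sum>i. hausdorff_gauge s (U i))"

definition hausdorff_measure :: "real \<Rightarrow> 'a::metric_space set \<Rightarrow> ennreal" where
  "hausdorff_measure s E = (SUP \<delta> \<in> {0<..}. hausdorff_premeasure s \<delta> E)"

text \<open>The type is restricted to Euclidean spaces, where the infimum is over a nonempty set, so
  that the dimension is a genuine real number.\<close>

definition hausdorff_dim :: "'a::euclidean_space set \<Rightarrow> real" where
  "hausdorff_dim E = Inf {s. 0 \<le> s \<and> hausdorff_measure s E = 0}"


definition exponential :: "'a::euclidean_space \<Rightarrow> 'a \<Rightarrow> complex" where
  "exponential \<xi> x = exp (- 2 * of_real pi * \<i> * of_real (x \<bullet> \<xi>))"

definition fourier_transform :: "'a::euclidean_space measure \<Rightarrow> 'a \<Rightarrow> complex" where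
  "fourier_transform \<mu> \<xi> = (\<integral>x. exponential \<xi> x \<partial>\<mu>)"

definition measure_support :: "'a::topological_space measure \<Rightarrow> 'a set" where
  "measure_support \<mu> = {x. \<forall>U. open U \<and> x \<in> U \<longrightarrow> emeasure \<mu> U \<noteq> 0}"

definition salem_measure :: "'a::euclidean_space measure \<Rightarrow> bool" where
  "salem_measure \<mu> \<longleftrightarrow>
     sets \<mu> = sets borel \<and> finite_measure \<mu> \<and> emeasure \<mu> (space \<mu>) \<noteq> 0 \<and>
     compact (measure_support \<mu>) \<and>
     (\<forall>\<epsilon>>0. \<exists>C. \<forall>\<xi>. norm \<xi> \<ge> 1 \<longrightarrow>
        norm (fourier_transform \<mu> \<xi>)
          \<le> C * norm \<xi> powr (- hausdorff_dim (measure_support \<mu>) / 2 + \<epsilon>))"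

definition dimensional_measure :: "real \<Rightarrow> 'a::euclidean_space measure \<Rightarrow> bool" where
  "dimensional_measure t \<mu> \<longleftrightarrow> hausdorff_dim (measure_support \<mu>) = t"


text \<open>Elements of $L^2(\mu)$ are handled through representatives: all notions below are invariant
  under changing functions on null sets.\<close>

definition square_integrable :: "'a measure \<Rightarrow> ('a \<Rightarrow> complex) \<Rightarrow> bool" where
  "square_integrable \<mu> f \<longleftrightarrow>
     f \<in> borel_measurable \<mu> \<and> integrable \<mu> (\<lambda>x. (norm (f x))\<^sup>2)"

definition L2_inner :: "'a measure \<Rightarrow> ('a \<Rightarrow> complex) \<Rightarrow> ('a \<Rightarrow> complex) \<Rightarrow> complex" where
  "L2_inner \<mu> f g = (\<integral>x. f x * cnj (g x) \<partial>\<mu>)"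

definition L2_norm :: "'a measure \<Rightarrow> ('a \<Rightarrow> complex) \<Rightarrow> real" where
  "L2_norm \<mu> f = sqrt (\<integral>x. (norm (f x))\<^sup>2 \<partial>\<mu>)"

text \<open>The family \<open>(e i)\<close>, \<open>i \<in> I\<close>, is an orthonormal system in $L^2(\mu)$ whose finite linear
  combinations are dense.\<close>

definition orthonormal_basis_L2 ::
    "'a measure \<Rightarrow> 'i set \<Rightarrow> ('i \<Rightarrow> 'a \<Rightarrow> complex) \<Rightarrow> bool" where
  "orthonormal_basis_L2 \<mu> I e \<longleftrightarrow>
     (\<forall>i\<in>I. square_integrable \<mu> (e i)) \<and>
     (\<forall>i\<in>I. \<forall>j\<in>I. L2_inner \<mu> (e i) (e j) = (if i = j then 1 else 0)) \<and>
     (\<forall>f. square_integrable \<mu> f \<longrightarrow>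
        (\<forall>\<epsilon>>0. \<exists>J c. finite J \<and> J \<subseteq> I \<and>
           L2_norm \<mu> (\<lambda>x. f x - (\<Sum>j\<in>J. c j * e j x)) < \<epsilon>))"


definition arc_measure :: "(real \<times> real) measure" where
  "arc_measure =
     distr (restrict_space lborel {-1/2..1/2}) borel (\<lambda>x. (x, sqrt (1 - x\<^sup>2)))"

lemma measurable_arc [measurable]:
  "(\<lambda>x. (x, sqrt (1 - x\<^sup>2))) \<in> restrict_space lborel {-1/2..1/2} \<rightarrow>\<^sub>M (borel :: (real \<times> real) measure)"
  by (rule measurable_restrict_space1, subst measurable_lborel2)
    (intro borel_measurable_continuous_onI continuous_intros)

lemma nn_integral_arc_measure:
  assumes "f \<in> borel_measurable borel"
  shows "(\<integral>\<^sup>+p. f p \<partial>arc_measure) =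
    (\<integral>\<^sup>+x\<in>{-1/2..1/2}. f (x, sqrt (1 - x\<^sup>2)) \<partial>lborel)"
  unfolding arc_measure_def
  by (subst nn_integral_distr[OF measurable_arc], use assms in simp)
    (subst nn_integral_restrict_space, simp_all)

lemma integral_arc_measure:
  fixes f :: "real \<times> real \<Rightarrow> 'b::{banach, second_countable_topology}"
  assumes "f \<in> borel_measurable borel"
  shows "(\<integral>p. f p \<partial>arc_measure) =
    (LINT x:{-1/2..1/2}|lborel. f (x, sqrt (1 - x\<^sup>2)))"
  unfolding arc_measure_def set_lebesgue_integral_def
  by (subst integral_distr[OF measurable_arc], use assms in simp)
    (subst integral_restrict_space, simp_all)

end

theory Submission
  imports Defs
begin

text \<open>Orthonormality is that of the characters of the circle, because the arc is a graph over an interval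
  of length one. For completeness, push the measure forward to the unit circle by
  \<open>(x, y) \<mapsto> cis (2 \<pi> x)\<close>, which is almost everywhere injective. Polynomials are dense in $L^2$ of any
  finite Borel measure carried by a compact set (regularity, Urysohn, Stone--Weierstrass), and polynomials
  in the real and imaginary part of \<open>cis (2 \<pi> x)\<close> are trigonometric polynomials in \<open>x\<close>.

  For the decay, the phase \<open>a x + b sqrt (1 - x\<^sup>2)\<close> has second derivative at least \<open>\<bar>b\<bar>\<close> in absolute
  value, which gives the bound \<open>\<bar>b\<bar> powr (- 1/2)\<close>; when \<open>\<bar>b\<bar> \<le> \<bar>a\<bar>\<close>, its first derivative is comparable to
  \<open>\<bar>a\<bar>\<close>, since the slope of the arc stays below \<open>3/5\<close>.\<close>

section \<open>Oscillatory integrals\<close>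

lemma has_vector_derivative_cis:
  assumes "(\<phi> has_real_derivative D) (at x within S)"
  shows "((\<lambda>x. cis (\<phi> x)) has_vector_derivative D *\<^sub>R (\<i> * cis (\<phi> x))) (at x within S)"
  using has_derivative_cis[OF assms[unfolded has_field_derivative_def]]
  by (simp add: has_vector_derivative_def mult.commute)

text \<open>Integration by parts: \<open>cis \<phi>\<close> is the derivative of \<open>F\<close>
  minus an error of norm \<open>\<bar>h\<bar>\<close>, where \<open>h\<close> is the derivative of
  \<open>- (1 / \<phi>')\<close>. As \<open>\<phi>''\<close> keeps its sign, the error integrates to
  a difference of values of \<open>1 / \<phi>'\<close>. Boundary terms and error contribute
  \<open>2 / r\<close> each.\<close>

lemma van_der_Corput_first_derivative:
  fixes \<phi> \<phi>' \<phi>'' :: "real \<Rightarrow> real"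
  assumes "c \<le> d" "0 < r"
    and \<phi>: "\<And>x. x \<in> {c..d} \<Longrightarrow> (\<phi> has_real_derivative \<phi>' x) (at x within {c..d})"
    and \<phi>': "\<And>x. x \<in> {c..d} \<Longrightarrow> (\<phi>' has_real_derivative \<phi>'' x) (at x within {c..d})"
    and lower: "\<And>x. x \<in> {c..d} \<Longrightarrow> r \<le> \<bar>\<phi>' x\<bar>"
    and sign: "(\<forall>x\<in>{c..d}. 0 \<le> \<phi>'' x) \<or> (\<forall>x\<in>{c..d}. \<phi>'' x \<le> 0)"
  shows "norm (integral {c..d} (\<lambda>x. cis (\<phi> x))) \<le> 4 / r"
proof -
  have nz: "\<phi>' x \<noteq> 0" if "x \<in> {c..d}" for x
    using lower[OF that] \<open>0 < r\<close> by auto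
  define F where "F x = (1 / \<phi>' x) *\<^sub>R (- \<i> * cis (\<phi> x))" for x
  define h where "h x = \<phi>'' x / (\<phi>' x)\<^sup>2" for x
  have inv: "((\<lambda>x. - (1 / \<phi>' x)) has_real_derivative h x) (at x within {c..d})" if "x \<in> {c..d}" for x
    unfolding h_def using \<phi>'[OF that] nz[OF that]
    by (auto intro!: derivative_eq_intros simp: power2_eq_square field_simps)
  have int_h: "(h has_integral (1 / \<phi>' c - 1 / \<phi>' d)) {c..d}"
    using fundamental_theorem_of_calculus[OF \<open>c \<le> d\<close>, of "\<lambda>x. - (1 / \<phi>' x)" h] inv
    by (simp add: has_real_derivative_iff_has_vector_derivative)
  have F: "(F has_vector_derivative cis (\<phi> x) + \<i> * h x * cis (\<phi> x)) (at x within {c..d})"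
    if x: "x \<in> {c..d}" for x
  proof -
    have 1: "((\<lambda>x. 1 / \<phi>' x) has_vector_derivative - h x) (at x within {c..d})"
      using DERIV_minus[OF inv[OF x]] by (simp add: has_real_derivative_iff_has_vector_derivative)
    have 2: "((\<lambda>x. - \<i> * cis (\<phi> x)) has_vector_derivative - \<i> * (\<phi>' x *\<^sub>R (\<i> * cis (\<phi> x)))) (at x within {c..d})"
      by (intro derivative_intros has_vector_derivative_cis \<phi> x)
    show ?thesis unfolding F_def
      by (rule has_vector_derivative_eq_rhs[OF has_vector_derivative_scaleR[OF 1[folded has_real_derivative_iff_has_vector_derivative] 2]])
         (use nz[OF x] in \<open>simp add: scaleR_conv_of_real field_simps\<close>)
  qed
  have int_F: "((\<lambda>x. cis (\<phi> x) + \<i> * h x * cis (\<phi> x)) has_integral F d - F c) {c..d}"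
    by (rule fundamental_theorem_of_calculus[OF \<open>c \<le> d\<close> F])
  have cont: "continuous_on {c..d} \<phi>"
    using \<phi> by (meson DERIV_continuous continuous_on_eq_continuous_within)
  have int_cis: "(\<lambda>x. cis (\<phi> x)) integrable_on {c..d}"
    by (intro integrable_continuous_interval continuous_intros cont)
  define E where "E x = \<i> * h x * cis (\<phi> x)" for x
  \<comment> \<open>No continuity of \<open>\<phi>''\<close> is at hand; \<open>E\<close> is
    integrable as the difference of an exact derivative and the continuous function
    \<open>cis \<phi>\<close>.\<close>
  have int_E: "E integrable_on {c..d}"
    using integrable_diff[OF has_integral_integrable[OF int_F] int_cis] by (simp add: E_def[abs_def])
  have "integral {c..d} (\<lambda>x. cis (\<phi> x) + E x) = integral {c..d} (\<lambda>x. cis (\<phi> x)) + integral {c..d} E"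
    by (rule integral_add[OF int_cis int_E])
  then have eq: "integral {c..d} (\<lambda>x. cis (\<phi> x)) = F d - F c - integral {c..d} E"
    using integral_unique[OF int_F] by (simp add: E_def)
  have bound: "\<bar>1 / \<phi>' x\<bar> \<le> 1 / r" if "x \<in> {c..d}" for x
    using lower[OF that] \<open>0 < r\<close> by (simp add: frac_le)
  have bound_F: "norm (F x) \<le> 1 / r" if "x \<in> {c..d}" for x
    using bound[OF that] by (simp add: F_def norm_mult)
  have "norm (integral {c..d} E) \<le> 2 / r"
  proof -
    \<comment> \<open>\<open>s\<close> is the constant sign of \<open>\<phi>''\<close>, which turns
      the integral of \<open>\<bar>h\<bar>\<close> into that of \<open>s * h\<close>, known in
      closed form.\<close>
    obtain s :: real where s: "\<bar>s\<bar> = 1" "\<forall>x\<in>{c..d}. \<bar>h x\<bar> = s * h x"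
    proof (cases "\<forall>x\<in>{c..d}. 0 \<le> \<phi>'' x")
      case True then show ?thesis by (intro that[of 1]) (auto simp: h_def)
    next
      case False then show ?thesis using sign
        by (intro that[of "-1"]) (auto simp: h_def divide_nonpos_nonneg)
    qed
    have int_sh: "((\<lambda>x. s * h x) has_integral s * (1 / \<phi>' c - 1 / \<phi>' d)) {c..d}"
      by (rule has_integral_mult_right[OF int_h])
    have "norm (integral {c..d} E) \<le> integral {c..d} (\<lambda>x. s * h x)"
      by (rule integral_norm_bound_integral[OF int_E has_integral_integrable[OF int_sh]])
         (use s in \<open>auto simp: E_def norm_mult\<close>)
    also have "\<dots> = s * (1 / \<phi>' c - 1 / \<phi>' d)" by (rule integral_unique[OF int_sh])
    also have "\<dots> \<le> \<bar>s\<bar> * \<bar>1 / \<phi>' c - 1 / \<phi>' d\<bar>" by (metis abs_ge_self abs_mult)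
    also have "\<dots> \<le> \<bar>1 / \<phi>' c\<bar> + \<bar>1 / \<phi>' d\<bar>" using s abs_triangle_ineq4[of "1 / \<phi>' c" "1 / \<phi>' d"] by simp
    also have "\<dots> \<le> 1 / r + 1 / r" using \<open>c \<le> d\<close> by (intro add_mono bound) auto
    also have "\<dots> = 2 / r" by simp
    finally show ?thesis .
  qed
  moreover have "norm (F d) \<le> 1 / r" "norm (F c) \<le> 1 / r" using bound_F \<open>c \<le> d\<close> by auto
  ultimately show ?thesis unfolding eq
    using norm_triangle_ineq4[of "F d - F c" "integral {c..d} E"] norm_triangle_ineq4[of "F d" "F c"]
    by (simp add: field_simps)
qed

text \<open>Away from the \<open>\<delta>\<close>-neighbourhood of \<open>x\<^sub>0\<close> the first derivative test applies with bound
  \<open>\<rho> \<delta>\<close>; the neighbourhood itself contributes at most \<open>2 \<delta>\<close>. The choice \<open>\<delta> = 1 / sqrt \<rho>\<close>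
  balances the two.\<close>

lemma van_der_Corput_stationary_point:
  fixes \<phi> \<phi>' \<phi>'' :: "real \<Rightarrow> real"
  assumes "c \<le> d" "0 < \<rho>"
    and \<phi>: "\<And>x. x \<in> {c..d} \<Longrightarrow> (\<phi> has_real_derivative \<phi>' x) (at x within {c..d})"
    and \<phi>': "\<And>x. x \<in> {c..d} \<Longrightarrow> (\<phi>' has_real_derivative \<phi>'' x) (at x within {c..d})"
    and lower: "\<And>x. x \<in> {c..d} \<Longrightarrow> \<rho> * \<bar>x - x\<^sub>0\<bar> \<le> \<bar>\<phi>' x\<bar>"
    and sign: "(\<forall>x\<in>{c..d}. 0 \<le> \<phi>'' x) \<or> (\<forall>x\<in>{c..d}. \<phi>'' x \<le> 0)"
  shows "norm (integral {c..d} (\<lambda>x. cis (\<phi> x))) \<le> 10 / sqrt \<rho>"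
proof -
  define \<delta> where "\<delta> = 1 / sqrt \<rho>"
  have \<delta>: "0 < \<delta>" "\<rho> * \<delta> = sqrt \<rho>" "4 / (\<rho> * \<delta>) = 4 * \<delta>"
    using \<open>0 < \<rho>\<close> by (auto simp: \<delta>_def real_div_sqrt)
  \<comment> \<open>The ends of the neighbourhood of \<open>x\<^sub>0\<close> are clipped to
    \<open>{c..d}\<close>, which also covers an \<open>x\<^sub>0\<close> outside the
    interval.\<close>
  define u where "u = max c (min d (x\<^sub>0 - \<delta>))"
  define v where "v = max c (min d (x\<^sub>0 + \<delta>))"
  have ord: "c \<le> u" "u \<le> v" "v \<le> d" "v - u \<le> 2 * \<delta>"
    using \<delta>(1) \<open>c \<le> d\<close> by (auto simp: u_def v_def max_def min_def)
  have cont: "continuous_on {c..d} (\<lambda>x. cis (\<phi> x))"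
    using \<phi> by (intro continuous_intros) (meson DERIV_continuous continuous_on_eq_continuous_within)
  have int: "(\<lambda>x. cis (\<phi> x)) integrable_on {p..q}" if "c \<le> p" "q \<le> d" for p q
    using that by (intro integrable_continuous_interval continuous_on_subset[OF cont]) auto
  have outer: "norm (integral {p..q} (\<lambda>x. cis (\<phi> x))) \<le> 4 * \<delta>"
    if pq: "c \<le> p" "p \<le> q" "q \<le> d" and away: "\<And>x. x \<in> {p..q} \<Longrightarrow> \<delta> \<le> \<bar>x - x\<^sub>0\<bar>" for p q
  proof -
    have sub: "{p..q} \<subseteq> {c..d}" using pq by auto
    have "\<rho> * \<delta> \<le> \<bar>\<phi>' x\<bar>" if "x \<in> {p..q}" for x
    proof -
      have "\<rho> * \<delta> \<le> \<rho> * \<bar>x - x\<^sub>0\<bar>" using away[OF that] \<open>0 < \<rho>\<close> by simp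
      also have "\<dots> \<le> \<bar>\<phi>' x\<bar>" using lower that sub by auto
      finally show ?thesis .
    qed
    then have "norm (integral {p..q} (\<lambda>x. cis (\<phi> x))) \<le> 4 / (\<rho> * \<delta>)"
      using sub sign \<open>0 < \<rho>\<close> \<delta>(1)
      by (intro van_der_Corput_first_derivative[OF pq(2), of _ \<phi> \<phi>' \<phi>''])
        (auto intro: DERIV_subset[OF \<phi>] DERIV_subset[OF \<phi>'])
    then show ?thesis using \<delta> by simp
  qed
  have left: "norm (integral {c..u} (\<lambda>x. cis (\<phi> x))) \<le> 4 * \<delta>"
  proof (cases "c < u")
    \<comment> \<open>A strict \<open>c < u\<close> means that clipping at \<open>c\<close> did not
      act, so \<open>u \<le> x\<^sub>0 - \<delta>\<close>. Otherwise the piece is a single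
      point.\<close>
    case True
    then show ?thesis using ord \<delta>(1) by (intro outer) (auto simp: u_def)
  qed (use ord \<delta>(1) in auto)
  have right: "norm (integral {v..d} (\<lambda>x. cis (\<phi> x))) \<le> 4 * \<delta>"
  proof (cases "v < d")
    case True
    then show ?thesis using ord \<delta>(1) by (intro outer) (auto simp: v_def)
  qed (use ord \<delta>(1) in auto)
  have "norm (integral {u..v} (\<lambda>x. cis (\<phi> x))) \<le> integral {u..v} (\<lambda>x. 1::real)"
    using ord by (intro integral_norm_bound_integral int) auto
  then have middle: "norm (integral {u..v} (\<lambda>x. cis (\<phi> x))) \<le> 2 * \<delta>" using ord by simp
  have split: "integral {c..d} (\<lambda>x. cis (\<phi> x)) = integral {c..u} (\<lambda>x. cis (\<phi> x))
      + integral {u..v} (\<lambda>x. cis (\<phi> x)) + integral {v..d} (\<lambda>x. cis (\<phi> x))"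
    using Henstock_Kurzweil_Integration.integral_combine[OF ord(1) order_trans[OF ord(2,3)] int[of c d]]
      Henstock_Kurzweil_Integration.integral_combine[OF ord(2,3) int[of u d]] ord
    by (simp add: add.assoc)
  have "norm (integral {c..d} (\<lambda>x. cis (\<phi> x))) \<le> 4 * \<delta> + 2 * \<delta> + 4 * \<delta>"
    unfolding split by (intro norm_triangle_mono left middle right)
  then show ?thesis by (simp add: \<delta>_def)
qed

section \<open>Density of polynomials\<close>

text \<open>A substitute for Minkowski's inequality that stays with squared norms, so errors can be
  tracked as nonnegative integrals without roots.\<close>

lemma nn_integral_norm_add_square_le:
  fixes f g :: "'a \<Rightarrow> 'b::euclidean_space"
  assumes [measurable]: "f \<in> borel_measurable M" "g \<in> borel_measurable M"
  shows "(\<integral>\<^sup>+x. ennreal ((norm (f x + g x))\<^sup>2) \<partial>M) \<le>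
    2 * (\<integral>\<^sup>+x. ennreal ((norm (f x))\<^sup>2) \<partial>M) + 2 * (\<integral>\<^sup>+x. ennreal ((norm (g x))\<^sup>2) \<partial>M)"
proof -
  have "ennreal ((norm (f x + g x))\<^sup>2) \<le>
      2 * ennreal ((norm (f x))\<^sup>2) + 2 * ennreal ((norm (g x))\<^sup>2)" for x
  proof -
    have "(norm (f x + g x))\<^sup>2 \<le> (norm (f x) + norm (g x))\<^sup>2"
      by (intro power_mono norm_triangle_ineq) simp
    also have "\<dots> \<le> 2 * (norm (f x))\<^sup>2 + 2 * (norm (g x))\<^sup>2"
      using sum_squares_ge_zero[of "norm (f x) - norm (g x)" 0]
      by (simp add: power2_eq_square algebra_simps)
    finally have "ennreal ((norm (f x + g x))\<^sup>2) \<le> ennreal (2 * (norm (f x))\<^sup>2 + 2 * (norm (g x))\<^sup>2)"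
      by (rule ennreal_leI)
    then show ?thesis by (simp add: ennreal_plus ennreal_mult)
  qed
  then have "(\<integral>\<^sup>+x. ennreal ((norm (f x + g x))\<^sup>2) \<partial>M) \<le>
      (\<integral>\<^sup>+x. 2 * ennreal ((norm (f x))\<^sup>2) + 2 * ennreal ((norm (g x))\<^sup>2) \<partial>M)"
    by (intro nn_integral_mono)
  also have "\<dots> = 2 * (\<integral>\<^sup>+x. ennreal ((norm (f x))\<^sup>2) \<partial>M) + 2 * (\<integral>\<^sup>+x. ennreal ((norm (g x))\<^sup>2) \<partial>M)"
    by (simp add: nn_integral_add nn_integral_cmult)
  finally show ?thesis .
qed

text \<open>Membership in the $L^2(M)$-closure of the polynomials, with \<open>e\<close> bounding
  the squared distance. Borel measurability is built in so that errors of sums can be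
  estimated.\<close>

definition L2_polynomially_approximable ::
    "'a::euclidean_space measure \<Rightarrow> ('a \<Rightarrow> 'b::euclidean_space) \<Rightarrow> bool" where
  "L2_polynomially_approximable M f \<longleftrightarrow> f \<in> borel_measurable borel \<and>
    (\<forall>e>0. \<exists>p. polynomial_function p \<and> (\<integral>\<^sup>+x. ennreal ((norm (f x - p x))\<^sup>2) \<partial>M) \<le> ennreal e)"

lemma borel_measurable_polynomial_function:
  fixes p :: "'a::euclidean_space \<Rightarrow> 'b::euclidean_space"
  assumes "polynomial_function p"
  shows "p \<in> borel_measurable borel"
  using assms by (intro borel_measurable_continuous_onI continuous_on_polymonial_function)

text \<open>The squared triangle inequality doubles both errors, so two errors of
  \<open>e / 4\<close> give \<open>e\<close>. This closedness carries the class from continuous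
  functions to indicators, and from simple functions to all of $L^2$.\<close>

lemma L2_polynomially_approximable_limit:
  fixes f :: "'a::euclidean_space \<Rightarrow> 'b::euclidean_space"
  assumes sets: "sets M = sets borel" and f: "f \<in> borel_measurable borel"
    and approx: "\<And>e. 0 < e \<Longrightarrow> \<exists>g. L2_polynomially_approximable M g \<and>
      (\<integral>\<^sup>+x. ennreal ((norm (f x - g x))\<^sup>2) \<partial>M) \<le> ennreal e"
  shows "L2_polynomially_approximable M f"
  unfolding L2_polynomially_approximable_def
proof (intro conjI allI impI f)
  note sets[measurable_cong]
  fix e :: real assume "0 < e"
  then obtain g where g: "L2_polynomially_approximable M g"
    "(\<integral>\<^sup>+x. ennreal ((norm (f x - g x))\<^sup>2) \<partial>M) \<le> ennreal (e / 4)"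
    using approx[of "e / 4"] by auto
  then obtain p where p: "polynomial_function p"
    "(\<integral>\<^sup>+x. ennreal ((norm (g x - p x))\<^sup>2) \<partial>M) \<le> ennreal (e / 4)"
    using \<open>0 < e\<close> unfolding L2_polynomially_approximable_def by (metis divide_pos_pos zero_less_numeral)
  have [measurable]: "p \<in> borel_measurable borel" "g \<in> borel_measurable borel" "f \<in> borel_measurable borel"
    using borel_measurable_polynomial_function[OF p(1)] g(1) f
    by (auto simp: L2_polynomially_approximable_def)
  have "(\<integral>\<^sup>+x. ennreal ((norm (f x - p x))\<^sup>2) \<partial>M) = (\<integral>\<^sup>+x. ennreal ((norm ((f x - g x) + (g x - p x)))\<^sup>2) \<partial>M)"
    by simp
  also have "\<dots> \<le> 2 * (\<integral>\<^sup>+x. ennreal ((norm (f x - g x))\<^sup>2) \<partial>M) + 2 * (\<integral>\<^sup>+x. ennreal ((norm (g x - p x))\<^sup>2) \<partial>M)"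
    by (rule nn_integral_norm_add_square_le) measurable
  also have "\<dots> \<le> 2 * ennreal (e / 4) + 2 * ennreal (e / 4)"
    by (intro add_mono mult_left_mono g p) auto
  also have "\<dots> = ennreal e"
    using \<open>0 < e\<close> by (simp add: mult_2 flip: ennreal_plus)
  finally show "\<exists>p. polynomial_function p \<and> (\<integral>\<^sup>+x. ennreal ((norm (f x - p x))\<^sup>2) \<partial>M) \<le> ennreal e"
    using p(1) by (intro exI[of _ p]) simp
qed

lemma L2_polynomially_approximable_add:
  fixes f g :: "'a::euclidean_space \<Rightarrow> 'b::euclidean_space"
  assumes sets: "sets M = sets borel"
    and fg: "L2_polynomially_approximable M f" "L2_polynomially_approximable M g"
  shows "L2_polynomially_approximable M (\<lambda>x. f x + g x)"
  unfolding L2_polynomially_approximable_def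
proof (intro conjI allI impI)
  note sets[measurable_cong]
  have [measurable]: "g \<in> borel_measurable borel" "f \<in> borel_measurable borel"
    using fg by (auto simp: L2_polynomially_approximable_def)
  show "(\<lambda>x. f x + g x) \<in> borel_measurable borel" by measurable
  fix e :: real assume "0 < e"
  then have "0 < e / 4" by simp
  then obtain p q where p: "polynomial_function p"
      "(\<integral>\<^sup>+x. ennreal ((norm (f x - p x))\<^sup>2) \<partial>M) \<le> ennreal (e / 4)"
    and q: "polynomial_function q"
      "(\<integral>\<^sup>+x. ennreal ((norm (g x - q x))\<^sup>2) \<partial>M) \<le> ennreal (e / 4)"
    using fg unfolding L2_polynomially_approximable_def by blast
  have [measurable]: "p \<in> borel_measurable borel" "q \<in> borel_measurable borel"
    using p(1) q(1) by (auto intro: borel_measurable_polynomial_function)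
  have "(\<integral>\<^sup>+x. ennreal ((norm (f x + g x - (p x + q x)))\<^sup>2) \<partial>M) = (\<integral>\<^sup>+x. ennreal ((norm ((f x - p x) + (g x - q x)))\<^sup>2) \<partial>M)"
    by (simp add: algebra_simps)
  also have "\<dots> \<le> 2 * (\<integral>\<^sup>+x. ennreal ((norm (f x - p x))\<^sup>2) \<partial>M) + 2 * (\<integral>\<^sup>+x. ennreal ((norm (g x - q x))\<^sup>2) \<partial>M)"
    by (rule nn_integral_norm_add_square_le) measurable
  also have "\<dots> \<le> 2 * ennreal (e / 4) + 2 * ennreal (e / 4)"
    by (intro add_mono mult_left_mono p q) auto
  also have "\<dots> = ennreal e"
    using \<open>0 < e\<close> by (simp add: mult_2 flip: ennreal_plus)
  finally show "\<exists>p. polynomial_function p \<and> (\<integral>\<^sup>+x. ennreal ((norm (f x + g x - p x))\<^sup>2) \<partial>M) \<le> ennreal e"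
    using p(1) q(1) by (intro exI[of _ "\<lambda>x. p x + q x"]) auto
qed

lemma L2_polynomially_approximable_sum:
  fixes f :: "'i \<Rightarrow> 'a::euclidean_space \<Rightarrow> 'b::euclidean_space"
  assumes "sets M = sets borel" "finite I" "\<And>i. i \<in> I \<Longrightarrow> L2_polynomially_approximable M (f i)"
  shows "L2_polynomially_approximable M (\<lambda>x. \<Sum>i\<in>I. f i x)"
  using assms(2,3)
proof (induction I rule: finite_induct)
  case empty
  have "L2_polynomially_approximable M (\<lambda>x. 0 :: 'b)"
    unfolding L2_polynomially_approximable_def by (auto intro!: exI[of _ "\<lambda>x. 0"])
  then show ?case by simp
next
  case (insert i I)
  then have "L2_polynomially_approximable M (\<lambda>x. f i x + (\<Sum>i\<in>I. f i x))"
    by (intro L2_polynomially_approximable_add assms(1)) auto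
  then show ?case using insert.hyps by simp
qed

section \<open>Finite Borel measures carried by a compact set\<close>

context
  fixes M :: "'a::euclidean_space measure" and K :: "'a set"
  assumes sets: "sets M = sets borel" and finite: "finite_measure M"
    and K: "compact K" "emeasure M (- K) = 0"
begin

interpretation finite_measure M by (rule finite)

private lemma sp: "space M = UNIV"
  using sets_eq_imp_space_eq[OF sets] by simp

text \<open>Stone--Weierstrass gives a uniform error below \<open>\<delta>\<close> on
  \<open>K\<close>, hence almost everywhere, and the squared error is then at most
  \<open>\<delta>\<^sup>2\<close> times the total mass.\<close>

lemma L2_polynomially_approximable_continuous:
  fixes f :: "'a \<Rightarrow> 'b::euclidean_space"
  assumes f: "continuous_on UNIV f"
  shows "L2_polynomially_approximable M f"
  unfolding L2_polynomially_approximable_def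
proof (intro conjI allI impI)
  show "f \<in> borel_measurable borel" using f by (rule borel_measurable_continuous_onI)
  fix e :: real assume "0 < e"
  \<comment> \<open>The summand 1 keeps the denominator positive for the zero measure.\<close>
  define \<delta> where "\<delta> = sqrt (e / (measure M UNIV + 1))"
  have m: "0 < measure M UNIV + 1" by (simp add: add_nonneg_pos)
  then have "0 < \<delta>" using \<open>0 < e\<close> by (simp add: \<delta>_def)
  obtain p where p: "polynomial_function p" "\<forall>x\<in>K. norm (f x - p x) < \<delta>"
    using Stone_Weierstrass_polynomial_function[OF K(1) continuous_on_subset[OF f] \<open>0 < \<delta>\<close>] by auto
  have "AE x in M. x \<in> K"
    using K by (intro AE_I[of _ _ "- K"]) (auto simp: sets compact_imp_closed)
  then have "AE x in M. ennreal ((norm (f x - p x))\<^sup>2) \<le> ennreal (\<delta>\<^sup>2)"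
  proof (rule eventually_mono)
    fix x assume "x \<in> K"
    then have "norm (f x - p x) \<le> \<delta>" using p(2) by (simp add: less_imp_le)
    then show "ennreal ((norm (f x - p x))\<^sup>2) \<le> ennreal (\<delta>\<^sup>2)"
      by (intro ennreal_leI power_mono) auto
  qed
  then have "(\<integral>\<^sup>+x. ennreal ((norm (f x - p x))\<^sup>2) \<partial>M) \<le> (\<integral>\<^sup>+x. ennreal (\<delta>\<^sup>2) \<partial>M)"
    by (rule nn_integral_mono_AE)
  also have "\<dots> = ennreal (\<delta>\<^sup>2 * measure M UNIV)"
    by (simp add: sp emeasure_eq_measure ennreal_mult)
  also have "\<dots> \<le> ennreal e"
    using m \<open>0 < e\<close> by (intro ennreal_leI) (simp add: \<delta>_def field_simps)
  finally show "\<exists>p. polynomial_function p \<and> (\<integral>\<^sup>+x. ennreal ((norm (f x - p x))\<^sup>2) \<partial>M) \<le> ennreal e"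
    using p(1) by blast
qed

text \<open>Regularity encloses \<open>A\<close> between a compact \<open>C\<close> and an open
  \<open>U\<close> with \<open>U - C\<close> of small measure. A Urysohn function that is 1 on
  \<open>C\<close> and 0 off \<open>U\<close> differs from the indicator only on
  \<open>U - C\<close>, and by at most 1.\<close>

lemma L2_polynomially_approximable_indicator:
  fixes y :: "'b::euclidean_space"
  assumes A: "A \<in> sets borel"
  shows "L2_polynomially_approximable M (\<lambda>x. indicator A x *\<^sub>R y)"
proof (rule L2_polynomially_approximable_limit[OF sets])
  show "(\<lambda>x. indicator A x *\<^sub>R y) \<in> borel_measurable borel" using A by measurable
  fix e :: real assume "0 < e"
  \<comment> \<open>\<open>U - C\<close> will have measure at most \<open>2 * d\<close>, so the
    squared error is at most \<open>2 * d * (norm y)\<^sup>2\<close>; the summand 1 covers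
    \<open>y = 0\<close>.\<close>
  define d where "d = e / (2 * ((norm y)\<^sup>2 + 1))"
  have y: "0 < (norm y)\<^sup>2 + 1" by (simp add: add_nonneg_pos)
  then have "0 < d" using \<open>0 < e\<close> by (simp add: d_def)
  have fin: "emeasure M (space M) \<noteq> \<infinity>" by simp
  obtain C where C: "C \<subseteq> A" "compact C" "emeasure M A < emeasure M C + d"
    using SUP_approx_ennreal[OF \<open>0 < d\<close> _ inner_regular[OF sets fin A]] fin by fastforce
  obtain U where U: "A \<subseteq> U" "open U" "emeasure M U < emeasure M A + d"
    using INF_approx_ennreal[OF \<open>0 < d\<close> outer_regular[OF sets fin A]] by auto
  have [measurable]: "C \<in> sets M" "U \<in> sets M" "A \<in> sets M"
    using C(2) U(2) A by (auto simp: sets compact_imp_closed)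
  have "measure M A \<le> measure M C + d" "measure M U \<le> measure M A + d"
    using C(3) U(3) \<open>0 < d\<close>
    by (auto simp: emeasure_eq_measure ennreal_plus[symmetric] ennreal_less_iff simp del: ennreal_plus)
  moreover have "measure M (U - C) = measure M U - measure M C"
    using C U by (intro finite_measure_Diff) auto
  ultimately have small: "measure M (U - C) \<le> 2 * d" by simp
  have "closed C" "closed (- U)" "C \<inter> (- U) = {}" using C U by (auto simp: compact_imp_closed)
  from Urysohn[OF this, of 1 "0::real"]
  obtain u :: "'a \<Rightarrow> real" where u: "continuous_on UNIV u" "\<And>x. u x \<in> closed_segment 1 0"
      "\<And>x. x \<in> C \<Longrightarrow> u x = 1" "\<And>x. x \<in> - U \<Longrightarrow> u x = 0"
    by blast
  have u01: "0 \<le> u x" "u x \<le> 1" for x using u(2)[of x] by (auto simp: closed_segment_eq_real_ivl)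
  have "ennreal ((norm (indicator A x *\<^sub>R y - u x *\<^sub>R y))\<^sup>2) \<le> ennreal ((norm y)\<^sup>2) * indicator (U - C) x" for x
  proof (cases "x \<in> U - C")
    case True
    have "\<bar>indicator A x - u x\<bar> \<le> 1" using u01[of x] by (auto split: split_indicator)
    then have "\<bar>indicator A x - u x\<bar> * norm y \<le> 1 * norm y" by (rule mult_right_mono) simp
    then have "norm (indicator A x *\<^sub>R y - u x *\<^sub>R y) \<le> norm y"
      by (simp flip: scaleR_diff_left)
    then have "ennreal ((norm (indicator A x *\<^sub>R y - u x *\<^sub>R y))\<^sup>2) \<le> ennreal ((norm y)\<^sup>2)"
      by (intro ennreal_leI power_mono) auto
    then show ?thesis using True by (simp only: indicator_simps mult_1_right)
  next
    case False
    then have "indicator A x = u x" using u(3,4)[of x] C(1) U(1) by (auto split: split_indicator)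
    then show ?thesis by simp
  qed
  then have "(\<integral>\<^sup>+x. ennreal ((norm (indicator A x *\<^sub>R y - u x *\<^sub>R y))\<^sup>2) \<partial>M)
      \<le> (\<integral>\<^sup>+x. ennreal ((norm y)\<^sup>2) * indicator (U - C) x \<partial>M)"
    by (intro nn_integral_mono)
  also have "\<dots> = ennreal ((norm y)\<^sup>2 * measure M (U - C))"
    by (simp add: emeasure_eq_measure ennreal_mult nn_integral_cmult_indicator)
  also have "\<dots> \<le> ennreal ((norm y)\<^sup>2 * (2 * d))"
    using small by (intro ennreal_leI mult_left_mono) auto
  also have "\<dots> \<le> ennreal e"
    using y \<open>0 < e\<close> by (intro ennreal_leI) (simp add: d_def field_simps)
  finally have "(\<integral>\<^sup>+x. ennreal ((norm (indicator A x *\<^sub>R y - u x *\<^sub>R y))\<^sup>2) \<partial>M) \<le> ennreal e" .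
  moreover have "L2_polynomially_approximable M (\<lambda>x. u x *\<^sub>R y)"
    using u(1) by (intro L2_polynomially_approximable_continuous continuous_on_scaleR continuous_on_const)
  ultimately show "\<exists>g. L2_polynomially_approximable M g \<and>
      (\<integral>\<^sup>+x. ennreal ((norm (indicator A x *\<^sub>R y - g x))\<^sup>2) \<partial>M) \<le> ennreal e"
    by blast
qed

lemma L2_polynomially_approximable_simple_function:
  fixes f :: "'a \<Rightarrow> 'b::euclidean_space"
  assumes f: "simple_function M f"
  shows "L2_polynomially_approximable M f"
proof -
  have eq: "f = (\<lambda>x. \<Sum>y\<in>range f. indicator (f -` {y}) x *\<^sub>R y)"
    by (rule ext, rule simple_function_indicator_representation_banach[OF f, unfolded sp Int_UNIV_right, OF UNIV_I])
  have fin: "finite (range f)" and meas: "f -` {y} \<in> sets borel" for y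
    using simple_functionD(1)[OF f] simple_functionD(2)[OF f, of "{y}"] by (simp_all add: sp sets)
  show ?thesis
    by (subst eq) (intro L2_polynomially_approximable_sum L2_polynomially_approximable_indicator sets fin meas)
qed

text \<open>Dominated convergence makes simple functions approximate \<open>f\<close> in $L^2$, and
  these are finite sums of scaled indicators.\<close>

theorem polynomial_functions_dense_L2:
  fixes f :: "'a \<Rightarrow> 'b::euclidean_space"
  assumes f: "f \<in> borel_measurable borel" and "integrable M (\<lambda>x. (norm (f x))\<^sup>2)" and "0 < e"
  obtains p where "polynomial_function p"
    "(\<integral>\<^sup>+x. ennreal ((norm (f x - p x))\<^sup>2) \<partial>M) \<le> ennreal e"
proof -
  note [measurable_cong] = sets and [measurable] = f
  have "f \<in> borel_measurable M" by measurable
  from borel_measurable_implies_sequence_metric[OF this, of 0]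
  obtain s where s: "\<And>i. simple_function M (s i)" "\<And>x. (\<lambda>i. s i x) \<longlonglongrightarrow> f x"
    "\<And>i x. norm (s i x) \<le> 2 * norm (f x)"
    by (auto simp: sp)
  have [measurable]: "s i \<in> borel_measurable M" for i
    by (rule borel_measurable_simple_function[OF s(1)])
  have "(\<lambda>i. \<integral>\<^sup>+x. ennreal ((norm (f x - s i x))\<^sup>2) \<partial>M) \<longlonglongrightarrow> (\<integral>\<^sup>+x. 0 \<partial>M)"
  proof (rule nn_integral_dominated_convergence)
    \<comment> \<open>The factor 9 is the square of 1 + 2, from
      \<open>norm (s i x) \<le> 2 * norm (f x)\<close>.\<close>
    have "integrable M (\<lambda>x. 9 * (norm (f x))\<^sup>2)" using assms(2) by simp
    then show "(\<integral>\<^sup>+x. ennreal (9 * (norm (f x))\<^sup>2) \<partial>M) < \<infinity>"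
      by (subst (asm) integrable_iff_bounded) simp
    show "AE x in M. ennreal ((norm (f x - s i x))\<^sup>2) \<le> ennreal (9 * (norm (f x))\<^sup>2)" for i
    proof (intro AE_I2 ennreal_leI)
      fix x
      have "norm (f x - s i x) \<le> 3 * norm (f x)"
        using norm_triangle_ineq4[of "f x" "s i x"] s(3)[of i x] by simp
      then have "(norm (f x - s i x))\<^sup>2 \<le> (3 * norm (f x))\<^sup>2" by (intro power_mono) auto
      then show "(norm (f x - s i x))\<^sup>2 \<le> 9 * (norm (f x))\<^sup>2" by (simp add: power_mult_distrib)
    qed
    have "(\<lambda>i. ennreal ((norm (f x - s i x))\<^sup>2)) \<longlonglongrightarrow> ennreal ((norm (f x - f x))\<^sup>2)" for x
      by (intro tendsto_intros s(2))
    then show "AE x in M. (\<lambda>i. ennreal ((norm (f x - s i x))\<^sup>2)) \<longlonglongrightarrow> 0" by simp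
  qed measurable
  then have lim: "(\<lambda>i. \<integral>\<^sup>+x. ennreal ((norm (f x - s i x))\<^sup>2) \<partial>M) \<longlonglongrightarrow> 0" by simp
  have "L2_polynomially_approximable M f"
  proof (rule L2_polynomially_approximable_limit[OF sets f])
    fix e :: real assume "0 < e"
    then have "\<forall>\<^sub>F i in sequentially. (\<integral>\<^sup>+x. ennreal ((norm (f x - s i x))\<^sup>2) \<partial>M) < ennreal e"
      by (intro order_tendstoD(2)[OF lim]) simp
    then obtain i where "(\<integral>\<^sup>+x. ennreal ((norm (f x - s i x))\<^sup>2) \<partial>M) < ennreal e"
      by (auto simp: eventually_sequentially)
    then show "\<exists>g. L2_polynomially_approximable M g \<and>
        (\<integral>\<^sup>+x. ennreal ((norm (f x - g x))\<^sup>2) \<partial>M) \<le> ennreal e"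
      using L2_polynomially_approximable_simple_function[OF s(1)] by (intro exI[of _ "s i"]) auto
  qed
  then show ?thesis using that \<open>0 < e\<close> unfolding L2_polynomially_approximable_def by blast
qed

end

section \<open>Fourier decay on the arc\<close>

lemma sets_arc_measure [measurable_cong, simp]: "sets arc_measure = sets borel"
  and space_arc_measure [simp]: "space arc_measure = UNIV"
  by (simp_all add: arc_measure_def)

lemma measurable_arc_lborel [measurable]:
  "(\<lambda>x. (x, sqrt (1 - x\<^sup>2))) \<in> borel \<rightarrow>\<^sub>M (borel :: (real \<times> real) measure)"
  by (intro borel_measurable_continuous_onI continuous_intros)

lemma emeasure_arc_measure:
  assumes "A \<in> sets borel"
  shows "emeasure arc_measure A = emeasure lborel {x \<in> {-1/2..1/2}. (x, sqrt (1 - x\<^sup>2)) \<in> A}"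
proof -
  have "emeasure arc_measure A = (\<integral>\<^sup>+p. indicator A p \<partial>arc_measure)"
    using assms by simp
  also have "\<dots> = (\<integral>\<^sup>+x. indicator {x \<in> {-1/2..1/2}. (x, sqrt (1 - x\<^sup>2)) \<in> A} x \<partial>lborel)"
    by (subst nn_integral_arc_measure, use assms in simp, intro nn_integral_cong)
      (simp split: split_indicator)
  also have "\<dots> = emeasure lborel {x \<in> {-1/2..1/2}. (x, sqrt (1 - x\<^sup>2)) \<in> A}"
  proof (rule nn_integral_indicator)
    have "(\<lambda>x. (x, sqrt (1 - x\<^sup>2))) -` A \<inter> space borel \<in> sets borel"
      by (rule measurable_sets[OF measurable_arc_lborel assms])
    moreover have "{x \<in> {-1/2..1/2}. (x, sqrt (1 - x\<^sup>2)) \<in> A} = (\<lambda>x. (x, sqrt (1 - x\<^sup>2))) -` A \<inter> space borel \<inter> {-1/2..1/2}"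
      by auto
    ultimately show "{x \<in> {-1/2..1/2}. (x, sqrt (1 - x\<^sup>2)) \<in> A} \<in> sets lborel"
      by (simp only: sets_lborel) (intro sets.Int, auto)
  qed
  finally show ?thesis .
qed

lemma emeasure_arc_measure_UNIV [simp]: "emeasure arc_measure UNIV = 1"
proof -
  have "{x::real \<in> {-1/2..1/2}. (x, sqrt (1 - x\<^sup>2)) \<in> UNIV} = {-1/2..1/2}" by blast
  then show ?thesis by (simp only: emeasure_arc_measure[OF borel_open[OF open_UNIV]]) simp
qed

lemma finite_measure_arc_measure: "finite_measure arc_measure"
  by (intro finite_measureI) simp

lemma exponential_eq_cis: "exponential \<xi> x = cis (- 2 * pi * (x \<bullet> \<xi>))"
  by (simp add: exponential_def cis_conv_exp algebra_simps)

lemma borel_measurable_exponential [measurable]: "exponential \<xi> \<in> borel_measurable borel"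
  unfolding exponential_def by (intro borel_measurable_continuous_onI continuous_intros)

text \<open>Passes from the Lebesgue integral to the gauge integral over the parameter interval, the
  form in which the van der Corput bounds are stated.\<close>

lemma integral_arc_measure_eq_integral:
  fixes f :: "real \<times> real \<Rightarrow> 'b::euclidean_space"
  assumes "f \<in> borel_measurable borel"
    and "continuous_on {-1/2..1/2} (\<lambda>x. f (x, sqrt (1 - x\<^sup>2)))"
  shows "(\<integral>p. f p \<partial>arc_measure) = integral {-1/2..1/2} (\<lambda>x. f (x, sqrt (1 - x\<^sup>2)))"
proof -
  have "set_integrable lborel {-1/2..1/2} (\<lambda>x. f (x, sqrt (1 - x\<^sup>2)))"
    unfolding set_integrable_def by (rule borel_integrable_compact[OF compact_Icc assms(2)])
  then show ?thesis
    unfolding integral_arc_measure[OF assms(1)] by (rule set_borel_integral_eq_integral(2))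
qed

lemma fourier_transform_arc_measure:
  "fourier_transform arc_measure (a, b) =
    integral {-1/2..1/2} (\<lambda>x. cis (- 2 * pi * (a * x + b * sqrt (1 - x\<^sup>2))))"
  unfolding fourier_transform_def
  by (subst integral_arc_measure_eq_integral)
    (auto simp: exponential_eq_cis inner_prod_def mult.commute intro!: continuous_intros)

section \<open>The slope of the arc and the derivatives of the phase\<close>

text \<open>This is the tangent of \<open>arcsin x\<close>, the slope of the graph with its sign
  reversed; the phase \<open>a * x + b * sqrt (1 - x\<^sup>2)\<close> has derivative
  \<open>a - b * arc_slope x\<close>.\<close>

definition arc_slope :: "real \<Rightarrow> real" where
  "arc_slope x = x / sqrt (1 - x\<^sup>2)"

lemma has_real_derivative_sqrt_one_minus_square:
  assumes "\<bar>x\<bar> < 1"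
  shows "((\<lambda>x. sqrt (1 - x\<^sup>2)) has_real_derivative - arc_slope x) (at x within S)"
proof -
  have "0 < 1 - x\<^sup>2" using assms by (simp add: abs_square_less_1)
  then show ?thesis unfolding arc_slope_def
    by (auto intro!: derivative_eq_intros simp: divide_simps)
qed

lemma has_real_derivative_arc_slope:
  assumes "\<bar>x\<bar> < 1"
  shows "(arc_slope has_real_derivative 1 / ((1 - x\<^sup>2) * sqrt (1 - x\<^sup>2))) (at x within S)"
proof -
  have pos: "0 < 1 - x\<^sup>2" using assms by (simp add: abs_square_less_1)
  then have "((\<lambda>x. x / sqrt (1 - x\<^sup>2)) has_real_derivative
      (1 * sqrt (1 - x\<^sup>2) - x * (- arc_slope x)) / (sqrt (1 - x\<^sup>2) * sqrt (1 - x\<^sup>2))) (at x within S)"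
    using assms by (intro DERIV_divide has_real_derivative_sqrt_one_minus_square) (auto intro!: derivative_eq_intros)
  moreover have "(1 * sqrt (1 - x\<^sup>2) - x * (- arc_slope x)) / (sqrt (1 - x\<^sup>2) * sqrt (1 - x\<^sup>2))
      = 1 / ((1 - x\<^sup>2) * sqrt (1 - x\<^sup>2))"
    using pos by (simp add: arc_slope_def field_simps power2_eq_square)
  ultimately show ?thesis by (simp add: arc_slope_def[abs_def])
qed

text \<open>The derivative of \<open>arc_slope\<close> is at least 1, so
  \<open>arc_slope z - z\<close> is nondecreasing. This supplies the linear growth of the phase
  derivative away from a stationary point.\<close>

lemma arc_slope_expanding:
  assumes "\<bar>x\<bar> < 1" "\<bar>y\<bar> < 1"
  shows "\<bar>x - y\<bar> \<le> \<bar>arc_slope x - arc_slope y\<bar>"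
proof -
  have *: "y - x \<le> arc_slope y - arc_slope x" if "-1 < x" "x \<le> y" "y < 1" for x y
  proof -
    have "arc_slope x - x \<le> arc_slope y - y"
    proof (rule DERIV_nonneg_imp_nondecreasing[OF \<open>x \<le> y\<close>])
      fix z assume "x \<le> z" "z \<le> y"
      then have z: "\<bar>z\<bar> < 1" using that by auto
      then have pos: "0 < 1 - z\<^sup>2" by (simp add: abs_square_less_1)
      then have "(1 - z\<^sup>2) * sqrt (1 - z\<^sup>2) \<le> 1" by (intro mult_le_one) auto
      then have "1 \<le> 1 / ((1 - z\<^sup>2) * sqrt (1 - z\<^sup>2))" using pos by simp
      moreover have "((\<lambda>z. arc_slope z - z) has_real_derivative 1 / ((1 - z\<^sup>2) * sqrt (1 - z\<^sup>2)) - 1) (at z)"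
        by (intro DERIV_diff has_real_derivative_arc_slope z DERIV_ident)
      ultimately show "\<exists>D. ((\<lambda>z. arc_slope z - z) has_real_derivative D) (at z) \<and> 0 \<le> D"
        by (intro exI conjI) auto
    qed
    then show ?thesis by simp
  qed
  show ?thesis using *[of x y] *[of y x] assms by (cases "x \<le> y") linarith+
qed

lemma arc_slope_surj: "\<exists>x. \<bar>x\<bar> < 1 \<and> arc_slope x = t"
proof (intro exI conjI)
  \<comment> \<open>The sine of \<open>arctan t\<close>.\<close>
  let ?x = "t / sqrt (1 + t\<^sup>2)"
  have pos: "0 < 1 + t\<^sup>2" by (simp add: add_pos_nonneg)
  have "\<bar>t\<bar> < sqrt (1 + t\<^sup>2)" by (rule real_less_rsqrt) simp
  then show "\<bar>?x\<bar> < 1" using pos by simp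
  have "1 - ?x\<^sup>2 = 1 / (1 + t\<^sup>2)" using pos by (simp add: power_divide field_simps)
  then show "arc_slope ?x = t" using pos by (simp add: arc_slope_def real_sqrt_divide)
qed

text \<open>The exact maximum is \<open>1 / sqrt 3\<close>, rounded up to a rational below 1. After
  squaring, the claim is \<open>25 / 9 * x\<^sup>2 \<le> 1 - x\<^sup>2\<close>, which follows from
  \<open>x\<^sup>2 \<le> 1 / 4\<close>.\<close>

lemma abs_arc_slope_le:
  assumes "\<bar>x\<bar> \<le> 1 / 2"
  shows "\<bar>arc_slope x\<bar> \<le> 3 / 5"
proof -
  have "x\<^sup>2 \<le> (1 / 2)\<^sup>2" using assms by (metis abs_ge_zero power2_abs power_mono)
  then have x2: "x\<^sup>2 \<le> 1 / 4" by (simp add: power2_eq_square)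
  have "\<bar>x\<bar> * (5 / 3) \<le> sqrt (1 - x\<^sup>2)"
    using x2 by (intro real_le_rsqrt) (simp add: power_mult_distrib power2_eq_square)
  moreover have "0 < sqrt (1 - x\<^sup>2)" using x2 by simp
  ultimately show ?thesis by (simp add: arc_slope_def divide_simps)
qed

lemma arc_phase_derivatives:
  fixes a b x :: real
  assumes "x \<in> {-1/2..1/2}"
  shows "((\<lambda>x. - 2 * pi * (a * x + b * sqrt (1 - x\<^sup>2))) has_real_derivative
      - 2 * pi * (a - b * arc_slope x)) (at x within S)"
    and "((\<lambda>x. - 2 * pi * (a - b * arc_slope x)) has_real_derivative
      2 * pi * b / ((1 - x\<^sup>2) * sqrt (1 - x\<^sup>2))) (at x within S)"
proof -
  have x: "\<bar>x\<bar> < 1" using assms by auto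
  show "((\<lambda>x. - 2 * pi * (a * x + b * sqrt (1 - x\<^sup>2))) has_real_derivative
      - 2 * pi * (a - b * arc_slope x)) (at x within S)"
    by (rule derivative_eq_intros has_real_derivative_sqrt_one_minus_square x refl | simp)+
  show "((\<lambda>x. - 2 * pi * (a - b * arc_slope x)) has_real_derivative
      2 * pi * b / ((1 - x\<^sup>2) * sqrt (1 - x\<^sup>2))) (at x within S)"
    by (rule derivative_eq_intros has_real_derivative_arc_slope x refl | simp)+
qed

text \<open>The second derivative of the phase has the sign of \<open>b\<close>, as its denominator
  is positive inside the unit interval.\<close>

lemma arc_phase_convexity:
  "(\<forall>x\<in>{-1/2..1/2}. 0 \<le> 2 * pi * b / ((1 - x\<^sup>2) * sqrt (1 - x\<^sup>2))) \<or>
   (\<forall>x\<in>{-1/2..1/2}. 2 * pi * b / ((1 - x\<^sup>2) * sqrt (1 - x\<^sup>2)) \<le> 0)"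
proof -
  have pos: "0 < (1 - x\<^sup>2) * sqrt (1 - x\<^sup>2)" if "x \<in> {-1/2..1/2}" for x :: real
  proof -
    have "\<bar>x\<bar> < 1" using that by auto
    then show ?thesis by (simp add: abs_square_less_1)
  qed
  show ?thesis
  proof (cases "0 \<le> b")
    case True
    then show ?thesis using pos by (intro disjI1 ballI divide_nonneg_pos) auto
  next
    case False
    then have "2 * pi * b \<le> 0" by (simp add: mult_nonneg_nonpos)
    then show ?thesis using pos by (intro disjI2 ballI divide_nonpos_pos)
  qed
qed

text \<open>The phase derivative is \<open>2 * pi * b * (arc_slope x - a / b)\<close>. Expansion of
  the slope gives growth at rate \<open>\<bar>b\<bar>\<close> from the stationary point, once the
  factor \<open>2 * pi\<close> is dropped.\<close>

lemma fourier_transform_arc_measure_le_vertical: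
  assumes "b \<noteq> 0"
  shows "norm (fourier_transform arc_measure (a, b)) \<le> 10 / sqrt \<bar>b\<bar>"
proof -
  \<comment> \<open>The stationary point of the phase on the open upper half circle; it may lie
    outside the parameter interval.\<close>
  obtain x\<^sub>0 where x\<^sub>0: "\<bar>x\<^sub>0\<bar> < 1" "arc_slope x\<^sub>0 = a / b" using arc_slope_surj by blast
  have lower: "\<bar>b\<bar> * \<bar>x - x\<^sub>0\<bar> \<le> \<bar>- 2 * pi * (a - b * arc_slope x)\<bar>" if "x \<in> {-1/2..1/2}" for x
  proof -
    have "\<bar>x - x\<^sub>0\<bar> \<le> \<bar>arc_slope x - arc_slope x\<^sub>0\<bar>"
      using that x\<^sub>0 by (intro arc_slope_expanding) auto
    then have "\<bar>b\<bar> * \<bar>x - x\<^sub>0\<bar> \<le> \<bar>b\<bar> * \<bar>arc_slope x - a / b\<bar>"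
      using x\<^sub>0(2) by (simp add: mult_left_mono)
    also have "\<dots> = \<bar>a - b * arc_slope x\<bar>"
      using assms by (simp add: abs_mult[symmetric] right_diff_distrib abs_minus_commute)
    also have "\<dots> \<le> 2 * pi * \<bar>a - b * arc_slope x\<bar>"
      using pi_gt3 mult_right_mono[of 1 "2 * pi" "\<bar>a - b * arc_slope x\<bar>"] by simp
    also have "\<dots> = \<bar>- 2 * pi * (a - b * arc_slope x)\<bar>" by (simp add: abs_mult)
    finally show ?thesis .
  qed
  show ?thesis unfolding fourier_transform_arc_measure
    by (rule van_der_Corput_stationary_point[OF _ _ arc_phase_derivatives lower arc_phase_convexity])
      (use assms in auto)
qed

lemma fourier_transform_arc_measure_le_horizontal:
  assumes "\<bar>b\<bar> \<le> \<bar>a\<bar>" "a \<noteq> 0"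
  shows "norm (fourier_transform arc_measure (a, b)) \<le> 2 / \<bar>a\<bar>"
proof -
  have lower: "2 * \<bar>a\<bar> \<le> \<bar>- 2 * pi * (a - b * arc_slope x)\<bar>" if "x \<in> {-1/2..1/2}" for x
  proof -
    have "\<bar>b * arc_slope x\<bar> \<le> \<bar>a\<bar> * (3 / 5)"
      unfolding abs_mult using assms that by (intro mult_mono abs_arc_slope_le) auto
    then have "2 / 5 * \<bar>a\<bar> \<le> \<bar>a - b * arc_slope x\<bar>" by linarith
    \<comment> \<open>Here \<open>2 * pi\<close> is rounded down to 5, which makes the constant an
      integer.\<close>
    then have "5 * (2 / 5 * \<bar>a\<bar>) \<le> 2 * pi * \<bar>a - b * arc_slope x\<bar>"
      using pi_gt3 by (intro mult_mono) auto
    then show ?thesis by (simp add: abs_mult)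
  qed
  have "norm (fourier_transform arc_measure (a, b)) \<le> 4 / (2 * \<bar>a\<bar>)"
    unfolding fourier_transform_arc_measure
    by (rule van_der_Corput_first_derivative[OF _ _ arc_phase_derivatives lower arc_phase_convexity])
      (use assms in auto)
  then show ?thesis by simp
qed

lemma norm_fourier_transform_arc_measure_le_1: "norm (fourier_transform arc_measure \<xi>) \<le> 1"
proof (cases \<xi>)
  case (Pair a b)
  have "norm (integral {-1/2..1/2} (\<lambda>x. cis (- 2 * pi * (a * x + b * sqrt (1 - x\<^sup>2))))) \<le>
      integral {-1/2..1/2} (\<lambda>x::real. 1::real)"
    by (intro integral_norm_bound_integral integrable_continuous_interval continuous_intros) auto
  then show ?thesis unfolding Pair fourier_transform_arc_measure by simp
qed

text \<open>The larger coordinate of \<open>\<xi>\<close> is comparable to its norm. It selects the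
  horizontal bound, of order -1, or the vertical one, which already has order -1/2.\<close>

lemma fourier_transform_arc_measure_decay:
  assumes "\<xi> \<noteq> 0"
  shows "norm (fourier_transform arc_measure \<xi>) \<le> 20 * norm \<xi> powr (- 1 / 2)"
proof (cases \<xi>)
  case (Pair a b)
  have pos: "0 < norm \<xi>" using assms by simp
  have powr: "norm \<xi> powr (- 1 / 2) = 1 / sqrt (norm \<xi>)"
    using pos by (simp add: powr_minus_divide powr_half_sqrt)
  have le: "norm \<xi> \<le> \<bar>a\<bar> + \<bar>b\<bar>"
    unfolding Pair norm_Pair by (simp add: sqrt_sum_squares_le_sum_abs)
  show ?thesis
  proof (cases "\<bar>b\<bar> \<le> \<bar>a\<bar>")
    case True
    then have a: "norm \<xi> \<le> 2 * \<bar>a\<bar>" "a \<noteq> 0" using le pos by auto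
    define z where "z = norm (fourier_transform arc_measure \<xi>)"
    have "z \<le> 2 / \<bar>a\<bar>"
      using fourier_transform_arc_measure_le_horizontal[OF True a(2)] by (simp add: z_def Pair)
    also have "\<dots> \<le> 4 / norm \<xi>" using a pos by (simp add: field_simps)
    finally have "z \<le> 4 / norm \<xi>" .
    \<comment> \<open>The trivial bound by the total mass 1 gives \<open>z\<^sup>2 \<le> z\<close>,
      which trades the decay of order -1 for order -1/2, including small
      \<open>\<xi>\<close>.\<close>
    moreover have "0 \<le> z" "z \<le> 1" using norm_fourier_transform_arc_measure_le_1 by (auto simp: z_def)
    then have "z\<^sup>2 \<le> z" by (simp add: power2_eq_square mult_left_le)
    ultimately have "z \<le> sqrt (4 / norm \<xi>)" by (intro real_le_rsqrt) simp
    then have "z \<le> 2 / sqrt (norm \<xi>)" by (simp add: real_sqrt_divide)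
    also have "\<dots> \<le> 20 / sqrt (norm \<xi>)" using pos by (intro divide_right_mono) auto
    finally show ?thesis unfolding powr z_def by simp
  next
    case False
    \<comment> \<open>The factor 2 obtained from \<open>le\<close> is relaxed to 4, whose square
      root is 2.\<close>
    then have b: "norm \<xi> \<le> 4 * \<bar>b\<bar>" "b \<noteq> 0" using le by auto
    have "sqrt (norm \<xi>) \<le> sqrt (4 * \<bar>b\<bar>)" using b by (intro real_sqrt_le_mono)
    then have "sqrt (norm \<xi>) \<le> 2 * sqrt \<bar>b\<bar>" by (simp add: real_sqrt_mult)
    then have "10 / sqrt \<bar>b\<bar> \<le> 20 / sqrt (norm \<xi>)" using pos b by (simp add: field_simps)
    then show ?thesis
      using fourier_transform_arc_measure_le_vertical[OF b(2), of a] powr unfolding Pair by simp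
  qed
qed

section \<open>Exponentials on the arc\<close>

text \<open>For a nonzero integer \<open>k\<close> the primitive \<open>F\<close> has period 1,
  which is the length of the interval.\<close>

lemma integral_cis_unit_interval:
  assumes "k \<in> \<int>" "k \<noteq> 0"
  shows "integral {-1/2..1/2} (\<lambda>x. cis (- 2 * pi * (k * x))) = 0"
proof -
  define F where "F x = (\<i> / (2 * pi * k)) * cis (- 2 * pi * (k * x))" for x
  have "((\<lambda>x. cis (- 2 * pi * (k * x))) has_integral F (1/2) - F (-1/2)) {-1/2..1/2}"
  proof (rule fundamental_theorem_of_calculus)
    fix x :: real
    have "((\<lambda>x. - 2 * pi * (k * x)) has_real_derivative - 2 * pi * k) (at x within {-1/2..1/2})"
      by (auto intro!: derivative_eq_intros)
    from has_vector_derivative_mult_right[OF has_vector_derivative_cis[OF this], of "\<i> / (2 * pi * k)"]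
    show "(F has_vector_derivative cis (- 2 * pi * (k * x))) (at x within {-1/2..1/2})"
      unfolding F_def using assms by (simp add: scaleR_conv_of_real)
  qed simp
  moreover have "cis (- 2 * pi * (k * (-1/2))) = cis (- 2 * pi * (k * (1/2)))"
  proof -
    have "cis (- 2 * pi * (k * (-1/2))) = cis (- 2 * pi * (k * (1/2))) * cis (2 * pi * k)"
      by (simp add: cis_mult algebra_simps)
    then show ?thesis using cis_multiple_2pi[OF assms(1)] by simp
  qed
  ultimately show ?thesis by (simp only: F_def diff_self integral_unique)
qed

lemma exponential_mult: "exponential \<xi> x * exponential \<eta> x = exponential (\<xi> + \<eta>) x"
proof -
  have "- 2 * pi * (x \<bullet> (\<xi> + \<eta>)) = - 2 * pi * (x \<bullet> \<xi>) + - 2 * pi * (x \<bullet> \<eta>)"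
    by (simp add: inner_add_right distrib_left)
  then show ?thesis unfolding exponential_eq_cis by (simp only: cis_mult)
qed

lemma cnj_exponential: "cnj (exponential \<xi> x) = exponential (- \<xi>) x"
  unfolding exponential_eq_cis by (simp add: cis_cnj)

lemma L2_inner_exponential: "L2_inner \<mu> (exponential \<xi>) (exponential \<eta>) = fourier_transform \<mu> (\<xi> - \<eta>)"
  unfolding L2_inner_def fourier_transform_def cnj_exponential exponential_mult by simp

text \<open>The inner product is the transform at the difference of the frequencies. Its second
  coordinate vanishes, so the square root drops out of the phase and a character integral over one
  period remains.\<close>

lemma orthonormal_exponentials_arc_measure:
  assumes "\<xi> \<in> \<int> \<times> {0}" "\<eta> \<in> \<int> \<times> {0}"
  shows "L2_inner arc_measure (exponential \<xi>) (exponential \<eta>) = (if \<xi> = \<eta> then 1 else 0)"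
proof -
  obtain m n where mn: "\<xi> = (m, 0)" "\<eta> = (n, 0)" "m - n \<in> \<int>" using assms by auto
  then show ?thesis
    using integral_cis_unit_interval[of "m - n"]
    by (auto simp: L2_inner_exponential fourier_transform_arc_measure simp flip: zero_prod_def)
qed

lemma square_integrable_exponential: "square_integrable arc_measure (exponential \<xi>)"
proof -
  interpret finite_measure arc_measure by (rule finite_measure_arc_measure)
  have "exponential \<xi> \<in> borel_measurable arc_measure" by measurable
  then show ?thesis by (simp add: square_integrable_def) (simp add: exponential_eq_cis)
qed

section \<open>The algebra of trigonometric polynomials\<close>

text \<open>The shape is that of the approximants in \<open>orthonormal_basis_L2\<close>: one
  coefficient for each frequency in a finite set.\<close>

definition trigonometric_polynomial :: "(real \<times> real \<Rightarrow> complex) \<Rightarrow> bool" where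
  "trigonometric_polynomial t \<longleftrightarrow>
    (\<exists>J c. finite J \<and> J \<subseteq> \<int> \<times> {0} \<and> t = (\<lambda>x. \<Sum>j\<in>J. c j * exponential j x))"

text \<open>Terms with equal frequency are merged by adding their coefficients along the fibres of
  \<open>\<xi>\<close>. Closure under sums then uses the disjoint union of the index sets, and
  closure under products their Cartesian product.\<close>

lemma trigonometric_polynomial_sum_exponential:
  assumes "finite I" "\<And>i. i \<in> I \<Longrightarrow> \<xi> i \<in> \<int> \<times> {0}"
  shows "trigonometric_polynomial (\<lambda>x. \<Sum>i\<in>I. c i * exponential (\<xi> i) x)"
proof -
  have "(\<Sum>i\<in>I. c i * exponential (\<xi> i) x) =
      (\<Sum>j\<in>\<xi> ` I. (\<Sum>i\<in>{i \<in> I. \<xi> i = j}. c i) * exponential j x)" for x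
    unfolding sum_distrib_right
    by (subst sum.image_gen[OF assms(1), of _ \<xi>]) (auto intro!: sum.cong)
  then show ?thesis
    using assms unfolding trigonometric_polynomial_def
    by (intro exI[of _ "\<xi> ` I"] exI[of _ "\<lambda>j. \<Sum>i\<in>{i \<in> I. \<xi> i = j}. c i"])
      (simp add: image_subset_iff)
qed

lemma trigonometric_polynomial_exponential:
  assumes "k \<in> \<int>"
  shows "trigonometric_polynomial (\<lambda>x. c * exponential (k, 0) x)"
  using trigonometric_polynomial_sum_exponential[of "{()}" "\<lambda>_. (k, 0)" "\<lambda>_. c"] assms by simp

lemma trigonometric_polynomial_const: "trigonometric_polynomial (\<lambda>x. c)"
  using trigonometric_polynomial_exponential[of 0 c]
  by (simp add: exponential_eq_cis flip: zero_prod_def)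

lemma trigonometric_polynomial_add:
  assumes "trigonometric_polynomial s" "trigonometric_polynomial t"
  shows "trigonometric_polynomial (\<lambda>x. s x + t x)"
proof -
  obtain I c where I: "finite I" "I \<subseteq> \<int> \<times> {0}" "s = (\<lambda>x. \<Sum>j\<in>I. c j * exponential j x)"
    using assms(1) unfolding trigonometric_polynomial_def by blast
  obtain J d where J: "finite J" "J \<subseteq> \<int> \<times> {0}" "t = (\<lambda>x. \<Sum>j\<in>J. d j * exponential j x)"
    using assms(2) unfolding trigonometric_polynomial_def by blast
  have "trigonometric_polynomial (\<lambda>x. \<Sum>i\<in>I <+> J. case_sum c d i * exponential (case_sum id id i) x)"
    using I J by (intro trigonometric_polynomial_sum_exponential) auto
  then show ?thesis using I(1) J(1) unfolding I(3) J(3) by (simp add: sum.Plus)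
qed

lemma trigonometric_polynomial_mult:
  assumes "trigonometric_polynomial s" "trigonometric_polynomial t"
  shows "trigonometric_polynomial (\<lambda>x. s x * t x)"
proof -
  obtain I c where I: "finite I" "I \<subseteq> \<int> \<times> {0}" "s = (\<lambda>x. \<Sum>j\<in>I. c j * exponential j x)"
    using assms(1) unfolding trigonometric_polynomial_def by blast
  obtain J d where J: "finite J" "J \<subseteq> \<int> \<times> {0}" "t = (\<lambda>x. \<Sum>j\<in>J. d j * exponential j x)"
    using assms(2) unfolding trigonometric_polynomial_def by blast
  have "fst p + snd p \<in> \<int> \<times> {0}" if "p \<in> I \<times> J" for p
  proof -
    have "fst p \<in> \<int> \<times> {0}" "snd p \<in> \<int> \<times> {0}" using that I(2) J(2) by auto
    then show ?thesis by auto
  qed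
  then have "trigonometric_polynomial
      (\<lambda>x. \<Sum>p\<in>I \<times> J. (c (fst p) * d (snd p)) * exponential (fst p + snd p) x)"
    using I J by (intro trigonometric_polynomial_sum_exponential) auto
  moreover have "s x * t x = (\<Sum>p\<in>I \<times> J. (c (fst p) * d (snd p)) * exponential (fst p + snd p) x)" for x
    unfolding I(3) J(3) sum_product sum.cartesian_product
    by (intro sum.cong) (auto simp: mult_ac simp flip: exponential_mult)
  ultimately show ?thesis by simp
qed

lemma cis_eq_exponential:
  "cis (2 * pi * fst x) = exponential (- 1, 0) x" "cis (- (2 * pi * fst x)) = exponential (1, 0) x"
  by (simp_all add: exponential_eq_cis inner_prod_def)

lemma trigonometric_polynomial_real_polynomial_function:
  assumes "real_polynomial_function p"
  shows "trigonometric_polynomial (\<lambda>x. of_real (p (cis (2 * pi * fst x))))"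
  using assms
proof (induction rule: real_polynomial_function.induct)
  case (linear f)
  \<comment> \<open>Euler's formulas for cosine and sine give the coefficients. The minus sign in
    \<open>exponential\<close> makes frequency -1 the one of
    \<open>cis (2 * pi * fst x)\<close>.\<close>
  have "complex_of_real (f (cis (2 * pi * fst x))) =
      (f 1 / 2 - \<i> * f \<i> / 2) * exponential (- 1, 0) x + (f 1 / 2 + \<i> * f \<i> / 2) * exponential (1, 0) x"
    for x :: "real \<times> real"
  proof -
    define \<theta> where "\<theta> = 2 * pi * fst x"
    have "f (cis \<theta>) = f (cos \<theta> *\<^sub>R 1 + sin \<theta> *\<^sub>R \<i>)"
      by (rule arg_cong[of _ _ f]) (simp add: complex_eq_iff)
    also have "\<dots> = cos \<theta> * f 1 + sin \<theta> * f \<i>"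
      using linear by (simp add: bounded_linear_def linear_add linear_cmul)
    finally show ?thesis
      unfolding cis_eq_exponential[symmetric] \<theta>_def[symmetric]
      by (simp add: complex_eq_iff algebra_simps)
  qed
  then show ?case
    by (simp add: trigonometric_polynomial_add trigonometric_polynomial_exponential)
qed (simp_all add: trigonometric_polynomial_const trigonometric_polynomial_add trigonometric_polynomial_mult)

lemma trigonometric_polynomial_polynomial_function:
  fixes p :: "complex \<Rightarrow> complex"
  assumes "polynomial_function p"
  shows "trigonometric_polynomial (\<lambda>x. p (cis (2 * pi * fst x)))"
proof -
  have *: "trigonometric_polynomial (\<lambda>x. of_real (f (p (cis (2 * pi * fst x)))))" if "bounded_linear f" for f
    using trigonometric_polynomial_real_polynomial_function[of "f \<circ> p"] assms that
    by (simp add: polynomial_function_def)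
  have "trigonometric_polynomial (\<lambda>x. of_real (Re (p (cis (2 * pi * fst x)))) +
      \<i> * of_real (Im (p (cis (2 * pi * fst x)))))"
    by (intro trigonometric_polynomial_add trigonometric_polynomial_mult trigonometric_polynomial_const *
        bounded_linear_Re bounded_linear_Im)
  then show ?thesis by (simp flip: complex_eq)
qed

text \<open>The inverse of \<open>x \<mapsto> cis (2 \<pi> x)\<close> on \<open>(-1/2, 1/2]\<close>; the truncation makes the argument of
  \<^const>\<open>arccos\<close> admissible for every complex number, so that the function is Borel on the whole plane.\<close>

definition turn :: "complex \<Rightarrow> real" where
  "turn z = (if 0 \<le> Im z then 1 else - 1) * arccos (max (- 1) (min 1 (Re z))) / (2 * pi)"

lemma borel_measurable_turn [measurable]: "turn \<in> borel_measurable borel"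
proof -
  have [measurable]: "(\<lambda>z. arccos (max (- 1) (min 1 (Re z)))) \<in> borel_measurable borel"
    by (intro borel_measurable_continuous_onI continuous_intros) auto
  have [measurable]: "Im \<in> borel_measurable borel"
    by (intro borel_measurable_continuous_onI continuous_intros)
  show ?thesis unfolding turn_def by measurable
qed

text \<open>\<open>arccos\<close> recovers the absolute value of the angle and the sign of the
  imaginary part restores its sign. At \<open>x = 1 / 2\<close> the imaginary part is 0 and the
  positive branch applies; \<open>- 1 / 2\<close> has the same image and is excluded.\<close>

lemma turn_cis:
  assumes "- 1 / 2 < x" "x \<le> 1 / 2"
  shows "turn (cis (2 * pi * x)) = x"
proof (cases "0 \<le> x")
  case True
  have "2 * pi * x \<le> 2 * pi * (1 / 2)" using assms by (intro mult_left_mono) auto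
  then have le: "0 \<le> 2 * pi * x" "2 * pi * x \<le> pi" using True by auto
  then have "0 \<le> sin (2 * pi * x)" by (rule sin_ge_zero)
  then show ?thesis using arccos_cos[OF le] by (simp add: turn_def)
next
  case False
  have "2 * pi * (- x) < 2 * pi * (1 / 2)" using assms by (intro mult_strict_left_mono) auto
  then have le: "0 < 2 * pi * (- x)" "2 * pi * (- x) < pi" using False by (auto simp: mult_pos_neg)
  then have "0 < sin (2 * pi * (- x))" by (rule sin_gt_zero)
  then have "sin (2 * pi * x) < 0" by simp
  then show ?thesis using arccos_cos[of "2 * pi * (- x)"] le by (simp add: turn_def)
qed

section \<open>Completeness of the exponentials\<close>

text \<open>On the arc only the endpoint with parameter \<open>- 1 / 2\<close> is not recovered,
  because the circle identifies it with the other end; a single parameter has length zero.\<close>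

lemma AE_arc_measure_turn:
  "AE p in arc_measure. (turn (cis (2 * pi * fst p)), sqrt (1 - (turn (cis (2 * pi * fst p)))\<^sup>2)) = p"
proof -
  define A :: "(real \<times> real) set" where
    "A = {p. \<not> (- 1 / 2 < fst p \<and> fst p \<le> 1 / 2 \<and> snd p = sqrt (1 - (fst p)\<^sup>2))}"
  have "A = - ({p. - 1 / 2 < fst p} \<inter> {p. fst p \<le> 1 / 2} \<inter> {p. snd p = sqrt (1 - (fst p)\<^sup>2)})"
    by (auto simp: A_def)
  also have "\<dots> \<in> sets borel"
    by (intro borel_comp sets.Int borel_open[OF open_Collect_less] borel_closed[OF closed_Collect_le]
        borel_closed[OF closed_Collect_eq] continuous_intros)
  finally have A: "A \<in> sets borel" .
  have "{x \<in> {- 1 / 2..1 / 2}. (x, sqrt (1 - x\<^sup>2)) \<in> A} = {- 1 / 2}" by (auto simp: A_def)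
  then have "emeasure arc_measure A = 0" by (simp only: emeasure_arc_measure[OF A]) simp
  then show ?thesis
    using A by (intro AE_I[of _ _ A]) (auto simp: A_def turn_cis)
qed

lemma exponentials_dense_arc_measure:
  assumes f: "square_integrable arc_measure f" and "0 < \<epsilon>"
  obtains t where "trigonometric_polynomial t" "L2_norm arc_measure (\<lambda>x. f x - t x) < \<epsilon>"
proof -
  interpret finite_measure arc_measure by (rule finite_measure_arc_measure)
  define w where "w p = cis (2 * pi * fst p)" for p :: "real \<times> real"
  have w [measurable]: "w \<in> borel_measurable borel"
    unfolding w_def by (intro borel_measurable_continuous_onI continuous_intros)
  have f2: "integrable arc_measure (\<lambda>x. (norm (f x))\<^sup>2)"
    using f by (simp add: square_integrable_def)
  have [measurable]: "f \<in> borel_measurable borel"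
    using f by (simp add: square_integrable_def measurable_cong_sets[OF sets_arc_measure refl])
  define M where "M = distr arc_measure borel w"
  \<comment> \<open>\<open>F\<close> is \<open>f\<close> carried over to the circle:
    \<open>turn\<close> recovers the parameter, and the graph map returns to the arc.\<close>
  define F where "F z = f (turn z, sqrt (1 - (turn z)\<^sup>2))" for z
  have [measurable]: "F \<in> borel_measurable borel" unfolding F_def by measurable
  have Fw: "AE p in arc_measure. F (w p) = f p"
    using AE_arc_measure_turn by (rule eventually_mono) (simp add: F_def w_def)
  have M: "sets M = sets borel" "finite_measure M"
    unfolding M_def by (auto intro!: finite_measure_distr)
  have "emeasure M (- sphere 0 1) = emeasure arc_measure (w -` (- sphere 0 1))"
    unfolding M_def by (subst emeasure_distr) (auto intro: borel_open)
  also have "w -` (- sphere 0 1) = {}" by (auto simp: w_def)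
  finally have null: "emeasure M (- sphere 0 1) = 0" by simp
  have "integrable arc_measure (\<lambda>p. (norm (F (w p)))\<^sup>2)"
    by (rule integrable_cong_AE_imp[OF f2]) (use Fw in \<open>auto elim: eventually_mono\<close>)
  then have F2: "integrable M (\<lambda>z. (norm (F z))\<^sup>2)"
    unfolding M_def by (subst integrable_distr_eq) auto
  \<comment> \<open>A squared error of \<open>\<epsilon>\<^sup>2 / 4\<close> means a norm of at most
    \<open>\<epsilon> / 2\<close>, hence strictly below \<open>\<epsilon>\<close>.\<close>
  obtain p where p: "polynomial_function p"
    "(\<integral>\<^sup>+z. ennreal ((norm (F z - p z))\<^sup>2) \<partial>M) \<le> ennreal (\<epsilon>\<^sup>2 / 4)"
    by (rule polynomial_functions_dense_L2[OF M compact_sphere null _ F2, of "\<epsilon>\<^sup>2 / 4"])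
      (use \<open>0 < \<epsilon>\<close> in auto)
  have [measurable]: "p \<in> borel_measurable borel" by (rule borel_measurable_polynomial_function[OF p(1)])
  have "(\<integral>\<^sup>+x. ennreal ((norm (f x - p (w x)))\<^sup>2) \<partial>arc_measure) =
      (\<integral>\<^sup>+x. ennreal ((norm (F (w x) - p (w x)))\<^sup>2) \<partial>arc_measure)"
    by (rule nn_integral_cong_AE) (use Fw in \<open>auto elim: eventually_mono\<close>)
  also have "\<dots> = (\<integral>\<^sup>+z. ennreal ((norm (F z - p z))\<^sup>2) \<partial>M)"
    unfolding M_def by (subst nn_integral_distr) auto
  also note p(2)
  finally have "enn2real (\<integral>\<^sup>+x. ennreal ((norm (f x - p (w x)))\<^sup>2) \<partial>arc_measure) \<le> \<epsilon>\<^sup>2 / 4"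
    by (intro enn2real_leI) auto
  then have "L2_norm arc_measure (\<lambda>x. f x - p (w x)) \<le> sqrt (\<epsilon>\<^sup>2 / 4)"
    unfolding L2_norm_def by (subst integral_eq_nn_integral) auto
  also have "\<dots> < \<epsilon>" using \<open>0 < \<epsilon>\<close> by (simp add: real_sqrt_divide)
  finally have "L2_norm arc_measure (\<lambda>x. f x - p (w x)) < \<epsilon>" .
  moreover have "trigonometric_polynomial (\<lambda>x. p (w x))"
    unfolding w_def by (rule trigonometric_polynomial_polynomial_function[OF p(1)])
  ultimately show ?thesis by (rule that[rotated])
qed

lemma orthonormal_basis_arc_measure:
  "orthonormal_basis_L2 arc_measure (\<int> \<times> {0}) exponential"
  unfolding orthonormal_basis_L2_def
proof (intro conjI ballI allI impI)
  fix f :: "real \<times> real \<Rightarrow> complex" and \<epsilon> :: real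
  assume "square_integrable arc_measure f" "0 < \<epsilon>"
  then obtain t where "trigonometric_polynomial t" "L2_norm arc_measure (\<lambda>x. f x - t x) < \<epsilon>"
    by (rule exponentials_dense_arc_measure)
  then show "\<exists>J c. finite J \<and> J \<subseteq> \<int> \<times> {0} \<and>
      L2_norm arc_measure (\<lambda>x. f x - (\<Sum>j\<in>J. c j * exponential j x)) < \<epsilon>"
    unfolding trigonometric_polynomial_def by blast
qed (simp_all only: square_integrable_exponential orthonormal_exponentials_arc_measure)

section \<open>Hausdorff dimension of the arc\<close>

text \<open>Projection does not increase distances, so a covering set of diameter \<open>d\<close>
  projects into an interval of length \<open>2 * d\<close>, and \<open>d \<le> d powr s\<close> for
  \<open>d \<le> 1\<close>. The projected cover must have total length at least
  \<open>b - a\<close>.\<close>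

lemma hausdorff_measure_ge_projection:
  fixes E :: "(real \<times> real) set"
  assumes s: "0 \<le> s" "s \<le> 1" and proj: "{a..b} \<subseteq> fst ` E"
  shows "ennreal (b - a) \<le> 2 * hausdorff_measure s E"
proof -
  \<comment> \<open>One scale suffices, since the measure is a supremum over scales; scale 1 keeps
    the diameters at most 1.\<close>
  have "ennreal ((b - a) / 2) \<le> hausdorff_premeasure s 1 E"
    unfolding hausdorff_premeasure_def
  proof (rule INF_greatest, clarify)
    fix U :: "nat \<Rightarrow> (real \<times> real) set"
    assume cover: "E \<subseteq> (\<Union>i. U i)" and U: "\<forall>i. bounded (U i) \<and> diameter (U i) \<le> 1"
    define d where "d i = diameter (U i)" for i
    have d: "0 \<le> d i" "d i \<le> 1" for i
      using U by (auto simp: d_def diameter_ge_0)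
    define c where "c i = (SOME q. q \<in> U i)" for i
    \<comment> \<open>The interval is centred at an arbitrary point of \<open>U i\<close>, hence the
      factor 2. Empty members get an empty interval, since \<open>c i\<close> is then
      unspecified.\<close>
    define B where "B i = (if U i = {} then {} else {fst (c i) - d i..fst (c i) + d i})" for i
    have gauge: "emeasure lborel (B i) \<le> 2 * hausdorff_gauge s (U i)" for i
    proof (cases "U i = {}")
      case False
      have "ennreal (d i) \<le> hausdorff_gauge s (U i)"
      proof (cases "s = 0 \<or> d i = 0")
        case True
        then show ?thesis using False d[of i] by (auto simp: hausdorff_gauge_def)
      next
        case neq: False
        then have "d i powr 1 \<le> d i powr s" using s d[of i] by (intro powr_mono') auto
        then show ?thesis using False neq d[of i] by (auto simp: hausdorff_gauge_def d_def intro!: ennreal_leI)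
      qed
      then have "2 * ennreal (d i) \<le> 2 * hausdorff_gauge s (U i)" by (intro mult_left_mono) auto
      then show ?thesis using False d[of i] by (simp add: B_def ennreal_mult)
    qed (simp add: B_def)
    have "{a..b} \<subseteq> (\<Union>i. B i)"
    proof
      fix x assume "x \<in> {a..b}"
      then obtain p where p: "p \<in> E" "x = fst p" using proj by auto
      then obtain i where i: "p \<in> U i" using cover by auto
      then have "c i \<in> U i" unfolding c_def by (rule someI)
      then have "dist p (c i) \<le> d i" unfolding d_def using U i by (intro diameter_bounded_bound) auto
      then have "dist (fst p) (fst (c i)) \<le> d i" using dist_fst_le order_trans by blast
      then show "x \<in> (\<Union>i. B i)" using i p by (auto simp: B_def dist_real_def abs_le_iff intro!: exI[of _ i])
    qed
    then have "emeasure lborel {a..b} \<le> emeasure lborel (\<Union>i. B i)"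
      by (intro emeasure_mono) (auto simp: B_def)
    also have "\<dots> \<le> (\<Sum>i. emeasure lborel (B i))"
      by (rule emeasure_subadditive_countably) (auto simp: B_def)
    also have "\<dots> \<le> (\<Sum>i. 2 * hausdorff_gauge s (U i))"
      by (intro suminf_le gauge) auto
    also have "\<dots> = 2 * (\<Sum>i. hausdorff_gauge s (U i))" by simp
    finally have "ennreal (1 / 2) * emeasure lborel {a..b} \<le> ennreal (1 / 2) * (2 * (\<Sum>i. hausdorff_gauge s (U i)))"
      by (intro mult_left_mono) auto
    moreover have "ennreal (1 / 2) * emeasure lborel {a..b} = ennreal ((b - a) / 2)"
    proof (cases "a \<le> b")
      case True
      then have "ennreal (1 / 2) * ennreal (b - a) = ennreal (1 / 2 * (b - a))"
        by (subst ennreal_mult) auto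
      then show ?thesis using True by (simp only: emeasure_lborel_Icc) simp
    qed (simp add: ennreal_neg)
    moreover have "ennreal (1 / 2) * (2 * S) = S" for S
    proof -
      have "ennreal (1 / 2) * 2 = ennreal (1 / 2 * 2)" by (subst ennreal_mult) auto
      then show ?thesis by (simp flip: mult.assoc)
    qed
    ultimately show "ennreal ((b - a) / 2) \<le> (\<Sum>i. hausdorff_gauge s (U i))" by simp
  qed
  also have "\<dots> \<le> hausdorff_measure s E"
    unfolding hausdorff_measure_def by (intro SUP_upper) auto
  finally have "2 * ennreal ((b - a) / 2) \<le> 2 * hausdorff_measure s E"
    by (intro mult_left_mono) auto
  moreover have "2 * ennreal ((b - a) / 2) = ennreal (b - a)"
  proof (cases "a \<le> b")
    case True
    have "2 * ennreal ((b - a) / 2) = ennreal (2 * ((b - a) / 2))" using True by (subst ennreal_mult) auto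
    also have "2 * ((b - a) / 2) = b - a" by simp
    finally show ?thesis .
  qed (simp add: ennreal_neg)
  ultimately show ?thesis by simp
qed

text \<open>Cutting the parameter interval at multiples of \<open>1 / n\<close> gives
  \<open>n + 1\<close> pieces of diameter at most \<open>L / n\<close>. Their gauge sum has order
  \<open>n powr (1 - s)\<close> and tends to 0.\<close>

lemma hausdorff_measure_lipschitz_curve:
  fixes g :: "real \<Rightarrow> 'a::metric_space"
  assumes "1 < s" and lip: "L-lipschitz_on {0..1} g"
  shows "hausdorff_measure s (g ` {0..1}) = 0"
proof -
  have L: "0 \<le> L" using lip by (rule lipschitz_on_nonneg)
  have bound: "hausdorff_premeasure s \<delta> (g ` {0..1}) \<le> ennreal (real (n + 1) * (L / n) powr s)"
    if n: "0 < n" "L / n \<le> \<delta>" for n :: nat and \<delta> :: real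
  proof -
    \<comment> \<open>The index \<open>n\<close> is included: its piece is the image of the
      parameter 1 alone, where the floor of \<open>x * n\<close> equals \<open>n\<close>. Later
      members are empty and have gauge 0.\<close>
    define U where "U i = (if i \<le> n then g ` ({i / n..(i + 1) / n} \<inter> {0..1}) else {})" for i :: nat
    have "compact (g ` {0..1})"
      by (intro compact_continuous_image lipschitz_on_continuous_on[OF lip] compact_Icc)
    then have bdd: "bounded (U i)" for i
      by (rule bounded_subset[OF compact_imp_bounded])
        (simp add: U_def image_mono del: Int_atLeastAtMost)
    have dist: "dist p q \<le> L / n" if "p \<in> U i" "q \<in> U i" for p q i
    proof -
      from that have "p \<in> g ` ({i / n..(i + 1) / n} \<inter> {0..1})" "q \<in> g ` ({i / n..(i + 1) / n} \<inter> {0..1})"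
        unfolding U_def by (meson empty_iff)+
      then obtain x y where xy: "p = g x" "q = g y" "x \<in> {i / n..(i + 1) / n} \<inter> {0..1}" "y \<in> {i / n..(i + 1) / n} \<inter> {0..1}"
        by blast
      have "dist p q \<le> L * dist x y"
        unfolding xy(1,2) using xy(3,4) by (intro lipschitz_onD[OF lip]) blast+
      also have "dist x y \<le> (i + 1) / n - i / n" using xy by (auto simp: dist_real_def abs_le_iff)
      also have "\<dots> = 1 / n" using n by (simp add: field_simps)
      finally show ?thesis using L by (simp add: mult_left_mono)
    qed
    have diam: "diameter (U i) \<le> L / n" for i
    proof (cases "U i = {}")
      case False
      then show ?thesis unfolding diameter_def using dist by (auto intro!: cSUP_least)
    qed (use L in simp)
    have cover: "g ` {0..1} \<subseteq> (\<Union>i. U i)"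
    proof
      fix p assume "p \<in> g ` {0..1}"
      then obtain x where x: "p = g x" "0 \<le> x" "x \<le> 1" by auto
      define i where "i = nat \<lfloor>x * n\<rfloor>"
      have "x * n \<le> n" using x n by simp
      moreover have i: "real i \<le> x * n" "x * n \<le> real i + 1" using x by (auto simp: i_def)
      ultimately have "i \<le> n" by linarith
      then have "p \<in> U i" using x i n by (auto simp: U_def field_simps)
      then show "p \<in> (\<Union>i. U i)" by blast
    qed
    have "hausdorff_premeasure s \<delta> (g ` {0..1}) \<le> (\<Sum>i. hausdorff_gauge s (U i))"
      unfolding hausdorff_premeasure_def
      by (intro INF_lower) (use cover bdd diam n order_trans in blast)
    also have "\<dots> = (\<Sum>i\<le>n. hausdorff_gauge s (U i))"
      by (intro suminf_finite) (auto simp: U_def hausdorff_gauge_def)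
    also have "\<dots> \<le> (\<Sum>i\<le>n. ennreal ((L / n) powr s))"
      using \<open>1 < s\<close> diam bdd
      by (intro sum_mono) (auto simp: hausdorff_gauge_def intro!: ennreal_leI powr_mono2 diameter_ge_0)
    also have "\<dots> = ennreal (real (n + 1) * (L / n) powr s)"
      by (simp add: ennreal_mult ennreal_of_nat_eq_real_of_nat)
    finally show ?thesis .
  qed
  have lim: "(\<lambda>n. real (n + 1) * (L / n) powr s) \<longlonglongrightarrow> 0"
  proof (rule Lim_transform_eventually)
    have "(\<lambda>n. (1 + 1 / real n) * (L powr s * real n powr (1 - s))) \<longlonglongrightarrow> (1 + 0) * (L powr s * 0)"
      using \<open>1 < s\<close>
      by (intro tendsto_intros lim_1_over_n tendsto_neg_powr filterlim_real_sequentially) auto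
    then show "(\<lambda>n. (1 + 1 / real n) * (L powr s * real n powr (1 - s))) \<longlonglongrightarrow> 0" by simp
    show "\<forall>\<^sub>F n in sequentially. (1 + 1 / real n) * (L powr s * real n powr (1 - s)) = real (n + 1) * (L / n) powr s"
      using eventually_gt_at_top[of 0]
      by (rule eventually_mono) (use L in \<open>simp add: powr_divide powr_diff field_simps\<close>)
  qed
  have "hausdorff_premeasure s \<delta> (g ` {0..1}) \<le> 0" if "0 < \<delta>" for \<delta>
  proof (rule tendsto_lowerbound)
    show "(\<lambda>n. ennreal (real (n + 1) * (L / n) powr s)) \<longlonglongrightarrow> 0"
      using tendsto_ennrealI[OF lim] by simp
    have "(\<lambda>n. L * (1 / real n)) \<longlonglongrightarrow> L * 0" by (intro tendsto_intros lim_1_over_n)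
    then have "\<forall>\<^sub>F n in sequentially. L * (1 / real n) < \<delta>" using that by (intro order_tendstoD) auto
    then show "\<forall>\<^sub>F n in sequentially. hausdorff_premeasure s \<delta> (g ` {0..1}) \<le> ennreal (real (n + 1) * (L / n) powr s)"
      using eventually_gt_at_top[of 0] by eventually_elim (rule bound, auto)
  qed simp
  then show ?thesis unfolding hausdorff_measure_def by (auto intro!: antisym SUP_least)
qed

text \<open>The arc is compact, so its complement is an open null set. Conversely, a neighbourhood
  of a point of the arc contains the image of a nondegenerate parameter interval.\<close>

lemma measure_support_arc_measure:
  "measure_support arc_measure = (\<lambda>x. (x, sqrt (1 - x\<^sup>2))) ` {-1/2..1/2}" (is "_ = ?\<gamma> ` ?I")
proof (intro antisym subsetI)
  fix p assume p: "p \<in> measure_support arc_measure"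
  show "p \<in> ?\<gamma> ` ?I"
  proof (rule ccontr)
    assume "p \<notin> ?\<gamma> ` ?I"
    have "compact (?\<gamma> ` ?I)" by (intro compact_continuous_image continuous_intros compact_Icc)
    then have op: "open (- (?\<gamma> ` ?I))" by (simp add: compact_imp_closed open_Compl)
    have "{x \<in> ?I. ?\<gamma> x \<in> - (?\<gamma> ` ?I)} = {}" by blast
    then have "emeasure arc_measure (- (?\<gamma> ` ?I)) = 0"
      by (simp only: emeasure_arc_measure[OF borel_open[OF op]] emeasure_empty)
    then show False using p op \<open>p \<notin> ?\<gamma> ` ?I\<close> unfolding measure_support_def by blast
  qed
next
  fix p assume "p \<in> ?\<gamma> ` ?I"
  then obtain x where x: "- 1 / 2 \<le> x" "x \<le> 1 / 2" "p = ?\<gamma> x" by auto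
  have "emeasure arc_measure U \<noteq> 0" if U: "open U" "p \<in> U" for U
  proof -
    have op: "open (?\<gamma> -` U)" by (intro open_vimage U continuous_intros)
    moreover have "x \<in> ?\<gamma> -` U" using U(2) x(3) by simp
    ultimately have "\<exists>e>0. \<forall>y. dist y x < e \<longrightarrow> y \<in> ?\<gamma> -` U"
      unfolding open_dist by (rule bspec)
    then obtain e where e: "0 < e" "\<And>y. dist y x < e \<Longrightarrow> ?\<gamma> y \<in> U"
      by blast
    \<comment> \<open>Clipping keeps \<open>l < r\<close> even when \<open>x\<close> is an endpoint,
      and halving \<open>e\<close> keeps the closed interval inside the open ball.\<close>
    define l r where "l = max (- 1 / 2) (x - e / 2)" and "r = min (1 / 2) (x + e / 2)"
    have lr: "l < r" using x e(1) unfolding l_def r_def max_def min_def by (auto; linarith)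
    have sub: "{l..r} \<subseteq> {y \<in> ?I. ?\<gamma> y \<in> U}"
    proof
      fix y assume y: "y \<in> {l..r}"
      then have "dist y x < e" using e(1) by (auto simp: l_def r_def dist_real_def)
      then show "y \<in> {y \<in> ?I. ?\<gamma> y \<in> U}" using e(2) y by (auto simp: l_def r_def)
    qed
    have "0 < emeasure lborel {l..r}" using lr by simp
    also have "\<dots> \<le> emeasure lborel {y \<in> ?I. ?\<gamma> y \<in> U}"
    proof (rule emeasure_mono[OF sub])
      have "{y \<in> ?I. ?\<gamma> y \<in> U} = ?I \<inter> ?\<gamma> -` U" by blast
      also have "\<dots> \<in> sets borel" using op by (intro sets.Int borel_open borel_closed) auto
      finally show "{y \<in> ?I. ?\<gamma> y \<in> U} \<in> sets lborel" by simp
    qed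
    also have "\<dots> = emeasure arc_measure U" by (rule emeasure_arc_measure[OF borel_open[OF U(1)], symmetric])
    finally show ?thesis by simp
  qed
  then show "p \<in> measure_support arc_measure" unfolding measure_support_def by blast
qed

text \<open>The mean value bound with slope at most \<open>3 / 5\<close> makes the second coordinate
  1-Lipschitz; adding the two coordinates gives 2. The shift by \<open>1 / 2\<close> moves the
  parameter to \<open>{0..1}\<close>.\<close>

lemma lipschitz_on_arc: "2-lipschitz_on {0..1} (\<lambda>t. (t - 1 / 2, sqrt (1 - (t - 1 / 2)\<^sup>2)))"
proof (rule lipschitz_onI)
  fix t u :: real assume tu: "t \<in> {0..1}" "u \<in> {0..1}"
  define x y where "x = t - 1 / 2" and "y = u - 1 / 2"
  have xy: "x \<in> {-1/2..1/2}" "y \<in> {-1/2..1/2}" using tu by (auto simp: x_def y_def)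
  have "norm (sqrt (1 - x\<^sup>2) - sqrt (1 - y\<^sup>2)) \<le> 3 / 5 * norm (x - y)"
  proof (rule field_differentiable_bound[OF convex_real_interval(5) _ _ xy])
    fix z :: real assume "z \<in> {-1/2..1/2}"
    then have z: "\<bar>z\<bar> \<le> 1 / 2" by auto
    then show "((\<lambda>x. sqrt (1 - x\<^sup>2)) has_field_derivative - arc_slope z) (at z within {-1/2..1/2})"
      by (intro has_real_derivative_sqrt_one_minus_square) simp
    show "norm (- arc_slope z) \<le> 3 / 5" using abs_arc_slope_le[OF z] by simp
  qed
  then have "dist (sqrt (1 - x\<^sup>2)) (sqrt (1 - y\<^sup>2)) \<le> dist x y"
    using norm_ge_zero[of "x - y"] unfolding dist_norm by linarith
  moreover have "dist (x, sqrt (1 - x\<^sup>2)) (y, sqrt (1 - y\<^sup>2)) \<le> dist x y + dist (sqrt (1 - x\<^sup>2)) (sqrt (1 - y\<^sup>2))"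
    unfolding dist_Pair_Pair by (rule sqrt_sum_squares_le_sum) auto
  moreover have "dist x y = dist t u" by (simp add: x_def y_def dist_real_def)
  ultimately show "dist (t - 1 / 2, sqrt (1 - (t - 1 / 2)\<^sup>2)) (u - 1 / 2, sqrt (1 - (u - 1 / 2)\<^sup>2)) \<le> 2 * dist t u"
    unfolding x_def[symmetric] y_def[symmetric] by simp
qed simp

text \<open>For \<open>s \<le> 1\<close> the measure is positive because the projection has length
  1; for \<open>s > 1\<close> it vanishes on a Lipschitz curve. The exponents with measure zero thus
  form \<open>{1<..}\<close>, with infimum 1.\<close>

lemma hausdorff_dim_support_arc_measure: "hausdorff_dim (measure_support arc_measure) = 1"
proof -
  have support: "measure_support arc_measure = (\<lambda>t. (t - 1 / 2, sqrt (1 - (t - 1 / 2)\<^sup>2))) ` {0..1}"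
  proof -
    have "{-1/2..1/2} = (\<lambda>t::real. t - 1 / 2) ` {0..1}" by simp
    then show ?thesis unfolding measure_support_arc_measure by (simp only: image_image)
  qed
  have "hausdorff_measure s (measure_support arc_measure) \<noteq> 0" if "0 \<le> s" "s \<le> 1" for s
  proof -
    have "{-1/2..1/2} \<subseteq> fst ` measure_support arc_measure"
      unfolding measure_support_arc_measure by (simp add: image_image)
    from hausdorff_measure_ge_projection[OF that this] show ?thesis by auto
  qed
  moreover have "hausdorff_measure s (measure_support arc_measure) = 0" if "1 < s" for s
    unfolding support by (rule hausdorff_measure_lipschitz_curve[OF that lipschitz_on_arc])
  ultimately have "{s. 0 \<le> s \<and> hausdorff_measure s (measure_support arc_measure) = 0} = {1<..}"
    by (auto simp: not_le) (meson not_le order.trans less_imp_le)+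
  then show ?thesis by (simp add: hausdorff_dim_def)
qed

section \<open>The Salem property and the conclusion\<close>

text \<open>Dimension 1 makes the required exponent \<open>- 1 / 2 + \<epsilon>\<close>, which
  weakens the proved decay when the norm of \<open>\<xi>\<close> is at least 1.\<close>

lemma salem_measure_arc_measure: "salem_measure arc_measure"
  unfolding salem_measure_def hausdorff_dim_support_arc_measure
proof (intro conjI allI impI)
  show "compact (measure_support arc_measure)"
    unfolding measure_support_arc_measure by (intro compact_continuous_image continuous_intros compact_Icc)
  fix \<epsilon> :: real assume "0 < \<epsilon>"
  show "\<exists>C. \<forall>\<xi>. 1 \<le> norm \<xi> \<longrightarrow> norm (fourier_transform arc_measure \<xi>) \<le> C * norm \<xi> powr (- 1 / 2 + \<epsilon>)"
  proof (intro exI allI impI)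
    fix \<xi> :: "real \<times> real" assume \<xi>: "1 \<le> norm \<xi>"
    then have "\<xi> \<noteq> 0" by auto
    then have "norm (fourier_transform arc_measure \<xi>) \<le> 20 * norm \<xi> powr (- 1 / 2)"
      by (rule fourier_transform_arc_measure_decay)
    also have "\<dots> \<le> 20 * norm \<xi> powr (- 1 / 2 + \<epsilon>)"
      using \<xi> \<open>0 < \<epsilon>\<close> by (intro mult_left_mono powr_mono) auto
    finally show "norm (fourier_transform arc_measure \<xi>) \<le> 20 * norm \<xi> powr (- 1 / 2 + \<epsilon>)" .
  qed
qed (simp_all add: finite_measure_arc_measure)

theorem mainTheorem7:
  shows "orthonormal_basis_L2 arc_measure (\<int> \<times> {0}) exponential \<and>
    (\<exists>C::real. \<forall>\<xi>. \<xi> \<noteq> 0 \<longrightarrow>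
       norm (fourier_transform arc_measure \<xi>) \<le> C * norm \<xi> powr (- 1 / 2)) \<and>
    salem_measure arc_measure \<and> dimensional_measure 1 arc_measure \<and>
    (\<exists>\<Lambda>. orthonormal_basis_L2 arc_measure \<Lambda> exponential)"
  using orthonormal_basis_arc_measure fourier_transform_arc_measure_decay salem_measure_arc_measure
    hausdorff_dim_support_arc_measure
  unfolding dimensional_measure_def by blast

end
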